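(* Let Assumptions 1 and 2 (stated in the context) hold and write $\mathcal{I}:=\bigcap_{i=0}^r\mathcal{S}_i$. Suppose $\mathcal{I}$ is compact and that for every $(x,u)\in\mathcal{I}$ there exists $q_{(x,u)}\in\mathbb{R}^m$ such that: if $b(u)=0$ then $\nabla b(u)^\top q_{(x,u)}>0$; and if $h_r(x,u)=0$ then $\frac{\partial h_r}{\partial u}(x,u)q_{(x,u)}+\frac{\partial h_r}{\partial x}(x,u)f(x,u)>0$. Assume that for all $(x,u)\in\mathcal{I}$, if $b(u)=0$ and $h_r(x,u)=0$, then $\nabla b(u)$ and $\frac{\partial h_r}{\partial u}(x,u)^\top$ are linearly independent. Further, assume: 1. The function $\Phi(w(\cdot))$ is $c$-strongly convex, with $c>0$. 2. The functions $-b(\cdot)$ and $-h_r(x,\cdot)$ are convex (the latter for any $x$). 3. There exists a unique optimizer $(x_*,u_* )$ of the steady-state problem (P), and it satisfies $b(u_* )>0$ and $h_r(x,u_* )>0$ for any $x$ for which there exists $u$ with $(x,u)\in\mathcal{I}$. 4. $d_3-d_4\left(1+\frac1\sigma\right)l_f>0$, where $l_f$ is the Lipschitz constant of $f$ on $\mathcal{I}$, and $d_3,d_4>0$ and $\sigma\in(0,1)$ are the constants described in the context. Then there exist $\alpha_*,\gamma_*,\epsilon_*>0$ such that, for any $\alpha>\alpha_*$, $\gamma>\gamma_*$ and $\epsilon\in(0,\epsilon_* )$, the global optimum $(x_*,u_* )$ is globally asymptotically stable relative to $\mathcal{I}$ for the closed loop (SGF-CL).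
   Context: Conventions: for differentiable $g:\mathbb{R}^n\to\mathbb{R}^k$, $\frac{\partial g}{\partial x}\in\mathbb{R}^{k\times n}$ (so partial derivatives of scalar functions are row vectors); for scalar $g$, $\nabla g=(\frac{\partial g}{\partial x})^\top$. Plant: $\dot\xi=f(\xi,\upsilon)$ with $f:\mathbb{R}^n\times\mathbb{R}^m\to\mathbb{R}^n$. Assumption 1: for every constant input $\upsilon\equiv u$ the system has a unique globally exponentially stable equilibrium; it is denoted $w(u)$, giving a map $w:\mathbb{R}^m\to\mathbb{R}^n$ with $f(w(u),u)=0$. Constants $d_3,d_4$: by a known consequence of Assumption 1 recalled in the paper from the literature, there exist a function $W:\mathbb{R}^n\times\mathbb{R}^m\to\mathbb{R}$ and constants $d_1,d_2,d_3,d_4>0$ such that for all $(x,u)$: $d_1\|x-w(u)\|^2\le W(x,u)\le d_2\|x-w(u)\|^2$, $\frac{\partial W}{\partial x}(x,u)f(x,u)\le-d_3\|x-w(u)\|^2$, $\|\frac{\partial W}{\partial u}(x,u)\|\le d_4\|x-w(u)\|$. Such $W$ and constants are fixed. Data: $\Phi,h:\mathbb{R}^n\to\mathbb{R}$, $b:\mathbb{R}^m\to\mathbb{R}$. Fix $\beta>0$ and set $h_0(x,u)=h(x)$, $h_i(x,u)=\frac{\partial h_{i-1}}{\partial x}(x,u)f(x,u)+\beta h_{i-1}(x,u)$ for $i\ge1$. Let $\mathcal{S}=\{(x,u): h(x)\ge0,\ b(u)\ge0\}$ and $\mathcal{S}_i=\{(x,u): b(u)\ge0,\ h_i(x,u)\ge0\}$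 for $i\ge0$, so $\mathcal{S}_0=\mathcal{S}$. Assumption 2: (1) there is an integer $r\ge1$ such that $f$ is $(r+1)$-times and $h$ is $(r+2)$-times continuously differentiable; $\mathcal{S}_r\ne\emptyset$; $\frac{\partial h_r}{\partial u}(x,u)\ne0$ for all $(x,u)\in\mathcal{S}_r$ with $h_r(x,u)=0$; and $\frac{\partial h_i}{\partial u}(x,u)=0$ for all $(x,u)\in\mathcal{S}_r$ and all $i<r$. (2) $b$ is twice continuously differentiable, and $b(u)=0$ implies $\nabla b(u)\neq0$ for all $(x,u)\in\mathcal{S}$. (3) $\Phi$ and $w$ are twice continuously differentiable. This fixes $r$. Constant $\sigma$: $\sigma\in(0,1)$ is a constant (its existence under the stated hypotheses is a separate lemma of the paper) such that for any $(x,u)\in\bigcap_{i=0}^r\mathcal{S}_i$ there exists $q_{(x,u)}\in\mathbb{R}^m$ with: if $b(u)=0$, then $\nabla b(u)^\top q_{(x,u)}\ge\sigma\|q_{(x,u)}\|\|\nabla b(u)\|$; if $h_r(x,u)=0$, then $\frac{\partial h_r}{\partial u}(x,u)q_{(x,u)}+\frac{\partial h_r}{\partial x}(x,u)f(x,u)\ge\sigma\|(f(x,u),q_{(x,u)})\|\,\|\nabla h_r(x,u)\|$, where $\nabla h_r$ is the full gradient in $\mathbb{R}^{n+m}$. Steady-state problem (P): $\min_{x,u}\Phi(x)$ s.t. $x=w(u)$, $h(x)\ge0$, $b(u)\ge0$. A function $\psi$ is $c$-strongly convex if $\psi(y)\ge\psi(x)+\nabla\psi(x)^\top(y-x)+\frac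 c2\|y-x\|^2$ for all $x,y$. Quadratic program (SGF), with parameters $\epsilon,\alpha,\gamma>0$: for given $(x,u)$, minimize over $q\in\mathbb{R}^m$ the function $\frac12\|q+\epsilon\frac{\partial w}{\partial u}(u)^\top\nabla\Phi(x)\|^2$ subject to $\nabla b(u)^\top q+\alpha b(u)\ge0$ and $\frac{\partial h_r}{\partial x}(x,u)f(x,u)+\frac{\partial h_r}{\partial u}(x,u)q+\gamma h_r(x,u)\ge0$. When feasible, its unique minimizer is $g_{\epsilon,\alpha,\gamma}(x,u)$. Closed loop (SGF-CL): $\dot\xi=f(\xi,\upsilon)$, $\dot\upsilon=g_{\epsilon,\alpha,\gamma}(\xi,\upsilon)$. Globally asymptotically stable relative to a set $\mathcal{I}$: trajectories starting in $\mathcal{I}$ stay in $\mathcal{I}$, the point is Lyapunov stable with respect to initial conditions in $\mathcal{I}$, and every trajectory with initial condition in $\mathcal{I}$ converges to the point as $t\to\infty$. *)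

theory Defs
  imports "HOL-Analysis.Analysis"
begin

definition grad :: "('a::real_inner \<Rightarrow> real) \<Rightarrow> 'a \<Rightarrow> 'a" where
  "grad g x = (THE D. GDERIV g x :> D)"

text \<open>A partial derivative (row vector) is represented by its transpose, so the product of
  the row vector with a column vector \<open>v\<close> becomes an inner product with \<open>v\<close>.\<close>

definition grad_x :: "('a::real_inner \<times> 'b::real_inner \<Rightarrow> real) \<Rightarrow> 'a \<times> 'b \<Rightarrow> 'a" where
  "grad_x g z = grad (\<lambda>x. g (x, snd z)) (fst z)"

definition grad_u :: "('a::real_inner \<times> 'b::real_inner \<Rightarrow> real) \<Rightarrow> 'a \<times> 'b \<Rightarrow> 'b" where
  "grad_u g z = grad (\<lambda>u. g (fst z, u)) (snd z)"

text \<open>\<open>k\<close>-times continuously differentiable on the whole space: all iterated directional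
  derivatives of order at most \<open>k\<close> exist and are continuous.\<close>

primrec cont_diff :: "nat \<Rightarrow> ('a::real_normed_vector \<Rightarrow> 'b::real_normed_vector) \<Rightarrow> bool" where
  "cont_diff 0 g \<longleftrightarrow> continuous_on UNIV g"
| "cont_diff (Suc k) g \<longleftrightarrow>
     g differentiable_on UNIV \<and> (\<forall>v. cont_diff k (\<lambda>x. frechet_derivative g (at x) v))"

definition strongly_convex :: "real \<Rightarrow> ('a::real_inner \<Rightarrow> real) \<Rightarrow> bool" where
  "strongly_convex c \<psi> \<longleftrightarrow>
     (\<forall>x y. \<psi> y \<ge> \<psi> x + grad \<psi> x \<bullet> (y - x) + c / 2 * (norm (y - x))\<^sup>2)"

text \<open>\<open>D\<close> is the domain of definition of the (possibly partial) vector field \<open>F\<close>.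
  For the time interval \<open>{0..}\<close> or \<open>{0..<T}\<close> the derivative at \<open>0\<close> is one-sided.\<close>

definition solution ::
  "('a::real_normed_vector \<Rightarrow> 'a) \<Rightarrow> 'a set \<Rightarrow> real set \<Rightarrow> (real \<Rightarrow> 'a) \<Rightarrow> bool" where
  "solution F D J z \<longleftrightarrow>
     (\<forall>t\<in>J. z t \<in> D \<and> (z has_vector_derivative F (z t)) (at t within J))"

definition globally_exp_stable :: "('a::real_normed_vector \<Rightarrow> 'a) \<Rightarrow> 'a \<Rightarrow> bool" where
  "globally_exp_stable F p \<longleftrightarrow>
     F p = 0 \<and>
     (\<forall>z0. \<exists>z. solution F UNIV {0..} z \<and> z 0 = z0) \<and>
     (\<exists>M>0. \<exists>k>0. \<forall>z. solution F UNIV {0..} z \<longrightarrow>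
        (\<forall>t\<ge>0. norm (z t - p) \<le> M * exp (- k * t) * norm (z 0 - p)))"

text \<open>The first two clauses say that trajectories from \<open>I\<close> exist and are defined for all future
  times (no solution from \<open>I\<close> ends in finite time); they prevent the remaining
  clauses (forward invariance, Lyapunov stability, attractivity) from holding vacuously.\<close>

definition globally_asymp_stable_rel ::
  "('a::real_normed_vector \<Rightarrow> 'a) \<Rightarrow> 'a set \<Rightarrow> 'a set \<Rightarrow> 'a \<Rightarrow> bool" where
  "globally_asymp_stable_rel F D I p \<longleftrightarrow>
     (\<forall>z0\<in>I. \<exists>z. solution F D {0..} z \<and> z 0 = z0) \<and>
     (\<forall>T>0. \<forall>y. solution F D {0..<T} y \<and> y 0 \<in> I \<longrightarrow>
        (\<exists>z. solution F D {0..} z \<and> (\<forall>t\<in>{0..<T}. z t = y t))) \<and>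
     (\<forall>z. solution F D {0..} z \<and> z 0 \<in> I \<longrightarrow> (\<forall>t\<ge>0. z t \<in> I)) \<and>
     (\<forall>e>0. \<exists>d>0. \<forall>z. solution F D {0..} z \<and> z 0 \<in> I \<and> dist (z 0) p < d \<longrightarrow>
        (\<forall>t\<ge>0. dist (z t) p < e)) \<and>
     (\<forall>z. solution F D {0..} z \<and> z 0 \<in> I \<longrightarrow> (z \<longlongrightarrow> p) at_top)"

primrec hcbf :: "real \<Rightarrow> ('a::real_inner \<times> 'b::real_inner \<Rightarrow> 'a) \<Rightarrow> ('a \<Rightarrow> real) \<Rightarrow> nat \<Rightarrow>
    'a \<times> 'b \<Rightarrow> real" where
  "hcbf \<beta> f h 0 = (\<lambda>z. h (fst z))"
| "hcbf \<beta> f h (Suc i) = (\<lambda>z. grad_x (hcbf \<beta> f h i) z \<bullet> f z + \<beta> * hcbf \<beta> f h i z)"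

definition safe_set :: "real \<Rightarrow> ('a::real_inner \<times> 'b::real_inner \<Rightarrow> 'a) \<Rightarrow> ('a \<Rightarrow> real) \<Rightarrow>
    ('b \<Rightarrow> real) \<Rightarrow> nat \<Rightarrow> ('a \<times> 'b) set" where
  "safe_set \<beta> f h b i = {(x, u). b u \<ge> 0 \<and> hcbf \<beta> f h i (x, u) \<ge> 0}"

definition plant_assumption ::
  "('a::real_normed_vector \<times> 'b \<Rightarrow> 'a) \<Rightarrow> ('b \<Rightarrow> 'a) \<Rightarrow> bool" where
  "plant_assumption f w \<longleftrightarrow>
     (\<forall>u. globally_exp_stable (\<lambda>x. f (x, u)) (w u) \<and>
          (\<forall>p. globally_exp_stable (\<lambda>x. f (x, u)) p \<longrightarrow> p = w u))"

definition constraint_assumption :: "nat \<Rightarrow> real \<Rightarrow> ((real ^ 'n) \<times> (real ^ 'm) \<Rightarrow> real ^ 'n) \<Rightarrow>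
    (real ^ 'm \<Rightarrow> real ^ 'n) \<Rightarrow> (real ^ 'n \<Rightarrow> real) \<Rightarrow> (real ^ 'n \<Rightarrow> real) \<Rightarrow>
    (real ^ 'm \<Rightarrow> real) \<Rightarrow> bool" where
  "constraint_assumption r \<beta> f w \<Phi> h b \<longleftrightarrow>
     r \<ge> 1 \<and> cont_diff (r + 1) f \<and> cont_diff (r + 2) h \<and>
     safe_set \<beta> f h b r \<noteq> {} \<and>
     (\<forall>z\<in>safe_set \<beta> f h b r. hcbf \<beta> f h r z = 0 \<longrightarrow> grad_u (hcbf \<beta> f h r) z \<noteq> 0) \<and>
     (\<forall>z\<in>safe_set \<beta> f h b r. \<forall>i<r. grad_u (hcbf \<beta> f h i) z = 0) \<and>
     cont_diff 2 b \<and>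
     (\<forall>(x, u)\<in>safe_set \<beta> f h b 0. b u = 0 \<longrightarrow> grad b u \<noteq> 0) \<and>
     cont_diff 2 \<Phi> \<and> cont_diff 2 w"

text \<open>Joint differentiability of \<open>W\<close> gives meaning to its partial derivatives and to its
  derivative along trajectories.\<close>

definition converse_lyapunov :: "((real ^ 'n) \<times> (real ^ 'm) \<Rightarrow> real ^ 'n) \<Rightarrow>
    (real ^ 'm \<Rightarrow> real ^ 'n) \<Rightarrow> ((real ^ 'n) \<times> (real ^ 'm) \<Rightarrow> real) \<Rightarrow>
    real \<Rightarrow> real \<Rightarrow> real \<Rightarrow> real \<Rightarrow> bool" where
  "converse_lyapunov f w W d1 d2 d3 d4 \<longleftrightarrow>
     d1 > 0 \<and> d2 > 0 \<and> d3 > 0 \<and> d4 > 0 \<and> W differentiable_on UNIV \<and>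
     (\<forall>x u. d1 * (norm (x - w u))\<^sup>2 \<le> W (x, u) \<and> W (x, u) \<le> d2 * (norm (x - w u))\<^sup>2 \<and>
            grad_x W (x, u) \<bullet> f (x, u) \<le> - d3 * (norm (x - w u))\<^sup>2 \<and>
            norm (grad_u W (x, u)) \<le> d4 * norm (x - w u))"

text \<open>\<open>hr\<close> stands for \<open>hcbf \<beta> f h r\<close>, and \<open>grad hr\<close> is its full gradient in \<open>(x, u)\<close>; the norm of
  the pair \<open>(f (x, u), q)\<close> is the Euclidean one.\<close>

definition sigma_constant :: "real \<Rightarrow> ((real ^ 'n) \<times> (real ^ 'm) \<Rightarrow> real ^ 'n) \<Rightarrow>
    ((real ^ 'n) \<times> (real ^ 'm) \<Rightarrow> real) \<Rightarrow> (real ^ 'm \<Rightarrow> real) \<Rightarrow>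
    ((real ^ 'n) \<times> (real ^ 'm)) set \<Rightarrow> bool" where
  "sigma_constant \<sigma> f hr b I \<longleftrightarrow>
     0 < \<sigma> \<and> \<sigma> < 1 \<and>
     (\<forall>(x, u)\<in>I. \<exists>q.
        (b u = 0 \<longrightarrow> grad b u \<bullet> q \<ge> \<sigma> * norm q * norm (grad b u)) \<and>
        (hr (x, u) = 0 \<longrightarrow>
           grad_u hr (x, u) \<bullet> q + grad_x hr (x, u) \<bullet> f (x, u)
             \<ge> \<sigma> * norm (f (x, u), q) * norm (grad hr (x, u))))"

definition steady_state_optimizer :: "(real ^ 'm \<Rightarrow> real ^ 'n) \<Rightarrow> (real ^ 'n \<Rightarrow> real) \<Rightarrow>
    (real ^ 'n \<Rightarrow> real) \<Rightarrow> (real ^ 'm \<Rightarrow> real) \<Rightarrow> (real ^ 'n) \<times> (real ^ 'm) \<Rightarrow> bool" where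
  "steady_state_optimizer w \<Phi> h b =
     is_arg_min (\<lambda>(x, u). \<Phi> x) (\<lambda>(x, u). x = w u \<and> h x \<ge> 0 \<and> b u \<ge> 0)"

definition sgf_feasible :: "real \<Rightarrow> real \<Rightarrow> ((real ^ 'n) \<times> (real ^ 'm) \<Rightarrow> real ^ 'n) \<Rightarrow>
    ((real ^ 'n) \<times> (real ^ 'm) \<Rightarrow> real) \<Rightarrow> (real ^ 'm \<Rightarrow> real) \<Rightarrow>
    (real ^ 'n) \<times> (real ^ 'm) \<Rightarrow> (real ^ 'm) set" where
  "sgf_feasible \<alpha> \<gamma> f hr b = (\<lambda>(x, u). {q.
     grad b u \<bullet> q + \<alpha> * b u \<ge> 0 \<and>
     grad_x hr (x, u) \<bullet> f (x, u) + grad_u hr (x, u) \<bullet> q + \<gamma> * hr (x, u) \<ge> 0})"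

text \<open>Only meaningful where \<^const>\<open>sgf_feasible\<close> is nonempty; there the minimizer is unique.\<close>

definition sgf :: "real \<Rightarrow> real \<Rightarrow> real \<Rightarrow> ((real ^ 'n) \<times> (real ^ 'm) \<Rightarrow> real ^ 'n) \<Rightarrow>
    (real ^ 'm \<Rightarrow> real ^ 'n) \<Rightarrow> (real ^ 'n \<Rightarrow> real) \<Rightarrow>
    ((real ^ 'n) \<times> (real ^ 'm) \<Rightarrow> real) \<Rightarrow> (real ^ 'm \<Rightarrow> real) \<Rightarrow>
    (real ^ 'n) \<times> (real ^ 'm) \<Rightarrow> real ^ 'm" where
  "sgf \<epsilon> \<alpha> \<gamma> f w \<Phi> hr b = (\<lambda>(x, u).
     arg_min_on
       (\<lambda>q. 1 / 2 *
          (norm (q + \<epsilon> *\<^sub>R (transpose (jacobian w (at u)) *v grad \<Phi> x)))\<^sup>2)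
       (sgf_feasible \<alpha> \<gamma> f hr b (x, u)))"

definition sgf_closed_loop :: "real \<Rightarrow> real \<Rightarrow> real \<Rightarrow> ((real ^ 'n) \<times> (real ^ 'm) \<Rightarrow> real ^ 'n) \<Rightarrow>
    (real ^ 'm \<Rightarrow> real ^ 'n) \<Rightarrow> (real ^ 'n \<Rightarrow> real) \<Rightarrow>
    ((real ^ 'n) \<times> (real ^ 'm) \<Rightarrow> real) \<Rightarrow> (real ^ 'm \<Rightarrow> real) \<Rightarrow>
    (real ^ 'n) \<times> (real ^ 'm) \<Rightarrow> (real ^ 'n) \<times> (real ^ 'm)" where
  "sgf_closed_loop \<epsilon> \<alpha> \<gamma> f w \<Phi> hr b z = (f z, sgf \<epsilon> \<alpha> \<gamma> f w \<Phi> hr b z)"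

end

theory Submission
  imports Defs "HOL-Complex_Analysis.Great_Picard"
begin

text \<open>
  Write \<open>e = x - w u\<close>, \<open>y = u - us\<close>, \<open>G (x, u)\<close> for the transposed Jacobian of \<open>w\<close> at \<open>u\<close> applied to
  \<open>\<nabla>\<Phi> x\<close>, and \<open>T = - \<epsilon> G\<close>, so that the input velocity \<open>g\<close> is the projection of \<open>T\<close> onto a polyhedron \<open>P\<close>
  cut out by two half spaces.  The delicate point is that \<open>g\<close> is not small when \<open>\<epsilon>\<close> is: the constraints
  can force a fast motion of \<open>u\<close>.  The proof rests on the observation that every such forced
  motion pushes \<open>u\<close> towards \<open>us\<close>, and by an amount comparable to its size.

  Indeed, by concavity of \<open>b\<close> and \<open>hr (x, \<cdot>)\<close> and since both are bounded below at \<open>us\<close> by some \<open>\<eta> > 0\<close>,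
  moving along \<open>us - u\<close> increases each constraint that is nearly active at a definite rate, while for
  large \<open>\<alpha>\<close> and \<open>\<gamma>\<close> a constraint that is not nearly active does not restrict bounded velocities
  (\<open>slack_keeps_feasible\<close>).  Hence \<open>g + (us - u) + \<rho> v \<in> P\<close> for all unit vectors \<open>v\<close> and a constant \<open>\<rho> > 0\<close>
  that depends neither on \<open>\<epsilon>\<close> nor on the gains, and the variational inequality of the projection gives
  \<open>(g - T) \<bullet> (us - u) \<ge> \<rho> \<bar>g - T\<bar>\<close> (\<open>closest_point_push\<close>).

  Consider \<open>V = W + K/2 \<bar>y\<bar>\<^sup>2\<close>.  Its derivative contains \<open>- d3 \<bar>e\<bar>\<^sup>2\<close> from the plant, a term
  \<open>d4 \<bar>e\<bar> \<bar>g\<bar> \<le> d4 \<bar>e\<bar> (\<bar>g - T\<bar> + \<epsilon> \<bar>G\<bar>)\<close> from the moving equilibrium, and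
  \<open>K y \<bullet> g \<le> - K \<epsilon> y \<bullet> G - K \<rho> \<bar>g - T\<bar>\<close>.  As \<open>\<bar>e\<bar>\<close> is bounded on the compact set \<open>I\<close>, a constant \<open>K\<close> can be
  chosen so that the last summand absorbs \<open>d4 \<bar>e\<bar> \<bar>g - T\<bar>\<close>.  The point \<open>us\<close> is an interior minimizer of the
  strongly convex \<open>\<Phi> \<circ> w\<close>, hence \<open>G (w us, us) = 0\<close> and \<open>y \<bullet> G (w u, u) \<ge> c \<bar>y\<bar>\<^sup>2\<close>; with \<open>G\<close> Lipschitz, what remains is a
  quadratic form in \<open>\<bar>e\<bar>\<close> and \<open>\<bar>y\<bar>\<close> that is negative definite once \<open>\<epsilon>\<close> is small
  (\<open>lyapunov_arith\<close>).  Since \<open>V\<close> is comparable to the squared distance to the equilibrium, all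
  trajectories in \<open>I\<close> converge exponentially (\<open>globally_asymp_stable_relI\<close>).

  Two further ingredients make this rigorous.  The set \<open>I\<close> is forward invariant by a comparison argument for
  \<open>b\<close> and \<open>hr\<close>, then downwards along the chain of barrier functions
  (\<open>safe_forward_invariant\<close>).  Solutions exist and can be continued: a large multiple of
  \<open>us - u\<close> satisfies both constraints strictly on \<open>I\<close>, so the projection is defined and continuous near \<open>I\<close>
  (\<open>projection_continuous\<close>), and Peano's theorem (\<open>peano_bounded\<close>) yields local solutions, whose length of
  existence is uniform on the compact invariant set \<open>I\<close>.  Stability is asserted for
  all solutions from a given initial point, so continuity of the closed-loop field suffices.
\<close>

section \<open>Gradients and functions of class \<open>C\<^sup>k\<close>\<close>

lemma frechet_derivative_eqI:
  "(g has_derivative g') (at x) \<Longrightarrow> frechet_derivative g (at x) = g'"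
  by (metis frechet_derivative_at)

lemma grad_inner:
  fixes g :: "'a::euclidean_space \<Rightarrow> real"
  assumes "(g has_derivative g') (at x)"
  shows "grad g x \<bullet> v = g' v"
proof -
  interpret bounded_linear g' using assms by (rule has_derivative_bounded_linear)
  define D where "D = (\<Sum>i\<in>Basis. g' i *\<^sub>R i)"
  have D: "h \<bullet> D = g' h" for h
  proof -
    have "g' h = g' (\<Sum>i\<in>Basis. (h \<bullet> i) *\<^sub>R i)" by (simp add: euclidean_representation)
    also have "\<dots> = (\<Sum>i\<in>Basis. (h \<bullet> i) * g' i)" by (simp add: sum scaleR)
    finally show ?thesis by (simp add: D_def inner_sum_right mult.commute)
  qed
  have "GDERIV g x :> D" using assms by (simp add: gderiv_def D)
  moreover have "E = D" if "GDERIV g x :> E" for E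
    using that assms D has_derivative_unique unfolding gderiv_def
    by (metis inner_commute vector_eq_ldot)
  ultimately have "grad g x = D" unfolding grad_def by blast
  then show ?thesis using D[of v] by (simp add: inner_commute)
qed

lemma grad_x_inner:
  fixes g :: "'a::euclidean_space \<times> 'b::euclidean_space \<Rightarrow> real"
  assumes "(g has_derivative g') (at z)"
  shows "grad_x g z \<bullet> v = g' (v, 0)"
proof -
  have "((\<lambda>x. g (x, snd z)) has_derivative (\<lambda>h. g' (h, 0))) (at (fst z))"
    by (rule has_derivative_compose[where g = g])
       (auto intro!: derivative_eq_intros simp: assms)
  then show ?thesis unfolding grad_x_def by (rule grad_inner)
qed

lemma grad_u_inner:
  fixes g :: "'a::euclidean_space \<times> 'b::euclidean_space \<Rightarrow> real"
  assumes "(g has_derivative g') (at z)"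
  shows "grad_u g z \<bullet> v = g' (0, v)"
proof -
  have "((\<lambda>u. g (fst z, u)) has_derivative (\<lambda>h. g' (0, h))) (at (snd z))"
    by (rule has_derivative_compose[where g = g])
       (auto intro!: derivative_eq_intros simp: assms)
  then show ?thesis unfolding grad_u_def by (rule grad_inner)
qed

lemma derivative_split:
  fixes g :: "'a::euclidean_space \<times> 'b::euclidean_space \<Rightarrow> real"
  assumes "(g has_derivative g') (at z)"
  shows "g' (v, q) = grad_x g z \<bullet> v + grad_u g z \<bullet> q"
proof -
  interpret bounded_linear g' using assms by (rule has_derivative_bounded_linear)
  have "g' (v, q) = g' ((v, 0) + (0, q))" by simp
  also have "\<dots> = g' (v, 0) + g' (0, q)" by (rule add)
  finally show ?thesis by (simp add: grad_x_inner[OF assms] grad_u_inner[OF assms])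
qed

lemma cont_diff_differentiable:
  "cont_diff (Suc k) g \<Longrightarrow> g differentiable (at x)"
  by (simp add: differentiable_on_def)

lemma cont_diff_has_derivative:
  "cont_diff (Suc k) g \<Longrightarrow> (g has_derivative frechet_derivative g (at x)) (at x)"
  by (metis cont_diff_differentiable frechet_derivative_works)

lemma cont_diff_SucD: "cont_diff (Suc k) g \<Longrightarrow> cont_diff k g"
proof (induction k arbitrary: g)
  case 0
  then show ?case by (simp add: differentiable_imp_continuous_on)
qed auto

lemma cont_diff_mono: "cont_diff k g \<Longrightarrow> j \<le> k \<Longrightarrow> cont_diff j g"
  by (induction k) (auto simp: le_Suc_eq simp del: cont_diff.simps dest: cont_diff_SucD)

lemma cont_diff_continuous: "cont_diff k g \<Longrightarrow> continuous_on S g"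
  using cont_diff_mono[of k g 0] continuous_on_subset by auto

text \<open>Introduction rule in terms of an explicitly known derivative; all closure properties below are
  inductions over the order with this rule in the step.\<close>

lemma cont_diff_SucI:
  assumes "\<And>x. (g has_derivative g' x) (at x)" "\<And>v. cont_diff k (\<lambda>x. g' x v)"
  shows "cont_diff (Suc k) g"
proof -
  have "frechet_derivative g (at x) = g' x" for x using assms(1) by (rule frechet_derivative_eqI)
  then show ?thesis using assms by (auto simp: differentiable_on_def differentiable_def)
qed

lemma cont_diff_const: "cont_diff k (\<lambda>x. c)"
proof (induction k arbitrary: c)
  case (Suc k)
  show ?case by (rule cont_diff_SucI[where g' = "\<lambda>x v. 0"]) (auto simp: Suc)
qed simp

lemma cont_diff_add:
  "cont_diff k f \<Longrightarrow> cont_diff k g \<Longrightarrow> cont_diff k (\<lambda>x. f x + g x)"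
proof (induction k arbitrary: f g)
  case (Suc k)
  show ?case
    by (rule cont_diff_SucI[OF has_derivative_add])
       (use Suc.prems cont_diff_has_derivative in \<open>auto intro!: Suc.IH\<close>)
qed (simp add: continuous_on_add)

lemma cont_diff_sum:
  "(\<And>i. i \<in> A \<Longrightarrow> cont_diff k (f i)) \<Longrightarrow> cont_diff k (\<lambda>x. \<Sum>i\<in>A. f i x)"
  by (induction A rule: infinite_finite_induct) (auto intro: cont_diff_const cont_diff_add)

lemma cont_diff_bilinear:
  assumes "bounded_bilinear B"
  shows "cont_diff k f \<Longrightarrow> cont_diff k g \<Longrightarrow> cont_diff k (\<lambda>x. B (f x) (g x))"
proof (induction k arbitrary: f g)
  case 0
  then show ?case by (simp add: bounded_bilinear.continuous_on[OF assms])
next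
  case (Suc k)
  show ?case
  proof (rule cont_diff_SucI)
    show "((\<lambda>x. B (f x) (g x)) has_derivative
      (\<lambda>v. B (f x) (frechet_derivative g (at x) v) + B (frechet_derivative f (at x) v) (g x))) (at x)" for x
      using Suc.prems by (intro bounded_bilinear.FDERIV[OF assms] cont_diff_has_derivative)
    show "cont_diff k (\<lambda>x. B (f x) (frechet_derivative g (at x) v) + B (frechet_derivative f (at x) v) (g x))" for v
      using Suc.prems cont_diff_SucD[of k f] cont_diff_SucD[of k g] by (intro cont_diff_add Suc.IH) auto
  qed
qed

lemmas cont_diff_inner = cont_diff_bilinear[OF bounded_bilinear_inner]
lemmas cont_diff_scaleR = cont_diff_bilinear[OF bounded_bilinear_scaleR]
lemmas cont_diff_mult = cont_diff_bilinear[OF bounded_bilinear_mult]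

lemma cont_diff_compose_linear:
  assumes "bounded_linear L"
  shows "cont_diff k g \<Longrightarrow> cont_diff k (\<lambda>x. g (L x))"
proof (induction k arbitrary: g)
  case 0
  then show ?case using assms
    by (auto intro: continuous_on_compose2[of UNIV g] linear_continuous_on)
next
  case (Suc k)
  show ?case
  proof (rule cont_diff_SucI)
    show "((\<lambda>x. g (L x)) has_derivative (\<lambda>h. frechet_derivative g (at (L x)) (L h))) (at x)" for x
      using Suc.prems by (intro has_derivative_compose[OF bounded_linear_imp_has_derivative[OF assms]] cont_diff_has_derivative)
    show "cont_diff k (\<lambda>x. frechet_derivative g (at (L x)) (L v))" for v
      using Suc.prems by (intro Suc.IH) auto
  qed
qed

lemma cont_diff_grad:
  fixes g :: "'a::euclidean_space \<Rightarrow> real"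
  assumes "cont_diff (Suc k) g"
  shows "cont_diff k (grad g)"
proof -
  have "grad g x = (\<Sum>i\<in>Basis. frechet_derivative g (at x) i *\<^sub>R i)" for x
    by (subst euclidean_representation[symmetric])
       (simp add: grad_inner[OF cont_diff_has_derivative[OF assms]])
  then have "grad g = (\<lambda>x. \<Sum>i\<in>Basis. frechet_derivative g (at x) i *\<^sub>R i)" by blast
  then show ?thesis using assms by (auto intro!: cont_diff_sum cont_diff_scaleR cont_diff_const)
qed

lemma cont_diff_grad_x:
  fixes g :: "'a::euclidean_space \<times> 'b::euclidean_space \<Rightarrow> real"
  assumes "cont_diff (Suc k) g"
  shows "cont_diff k (grad_x g)"
proof -
  have "grad_x g z = (\<Sum>i\<in>Basis. frechet_derivative g (at z) (i, 0) *\<^sub>R i)" for z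
    by (subst euclidean_representation[symmetric])
       (simp add: grad_x_inner[OF cont_diff_has_derivative[OF assms]])
  then have "grad_x g = (\<lambda>z. \<Sum>i\<in>Basis. frechet_derivative g (at z) (i, 0) *\<^sub>R i)" by blast
  then show ?thesis using assms by (auto intro!: cont_diff_sum cont_diff_scaleR cont_diff_const)
qed

lemma cont_diff_grad_u:
  fixes g :: "'a::euclidean_space \<times> 'b::euclidean_space \<Rightarrow> real"
  assumes "cont_diff (Suc k) g"
  shows "cont_diff k (grad_u g)"
proof -
  have "grad_u g z = (\<Sum>i\<in>Basis. frechet_derivative g (at z) (0, i) *\<^sub>R i)" for z
    by (subst euclidean_representation[symmetric])
       (simp add: grad_u_inner[OF cont_diff_has_derivative[OF assms]])
  then have "grad_u g = (\<lambda>z. \<Sum>i\<in>Basis. frechet_derivative g (at z) (0, i) *\<^sub>R i)" by blast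
  then show ?thesis using assms by (auto intro!: cont_diff_sum cont_diff_scaleR cont_diff_const)
qed

text \<open>Each step of the recursion costs one derivative of the previous barrier function, so
  \<open>r\<close> steps starting from class \<open>C\<^bsup>r+2\<^esup>\<close> still leave a function of class \<open>C\<^sup>2\<close>.\<close>

lemma cont_diff_hcbf:
  fixes f :: "'a::euclidean_space \<times> 'b::euclidean_space \<Rightarrow> 'a"
  assumes "cont_diff (r + 1) f" "cont_diff (r + 2) h" "i + k = r + 2"
  shows "cont_diff k (hcbf \<beta> f h i)"
  using assms(3)
proof (induction i arbitrary: k)
  case 0
  then show ?case using assms(2)
    by (simp del: cont_diff.simps add: cont_diff_compose_linear[OF bounded_linear_fst])
next
  case (Suc i)
  from Suc.IH[of "Suc k"] Suc.prems have *: "cont_diff (Suc k) (hcbf \<beta> f h i)" by simp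
  have "cont_diff k f" using Suc.prems by (intro cont_diff_mono[OF assms(1)]) auto
  then show ?case
    using * by (auto simp del: cont_diff.simps intro!: cont_diff_add cont_diff_inner cont_diff_mult cont_diff_const
        cont_diff_grad_x dest: cont_diff_SucD)
qed

text \<open>The operator norm of the derivative is bounded through its finitely many directional derivatives along
  the basis, each of which is continuous.\<close>

lemma cont_diff_lipschitz:
  fixes g :: "'a::euclidean_space \<Rightarrow> 'b::real_normed_vector"
  assumes "cont_diff 1 g" "compact K" "convex K"
  obtains L where "L > 0" "\<And>x y. x \<in> K \<Longrightarrow> y \<in> K \<Longrightarrow> norm (g x - g y) \<le> L * norm (x - y)"
proof -
  let ?D = "\<lambda>x. frechet_derivative g (at x)"
  have d: "(g has_derivative ?D x) (at x)" for x
    using assms(1) by (intro cont_diff_has_derivative[of 0]) simp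
  have "\<exists>B. \<forall>x\<in>K. norm (?D x i) \<le> B" for i
  proof -
    have "continuous_on UNIV (\<lambda>x. ?D x i)" using assms(1) by simp
    then have "continuous_on K (\<lambda>x. ?D x i)" by (rule continuous_on_subset) simp
    from compact_imp_bounded[OF compact_continuous_image[OF this assms(2)]]
    show ?thesis by (auto simp: bounded_iff)
  qed
  then obtain B where B: "\<And>i x. x \<in> K \<Longrightarrow> norm (?D x i) \<le> B i" by metis
  define L where "L = \<bar>\<Sum>i\<in>Basis. B i\<bar> + 1"
  have "onorm (?D x) \<le> L" if "x \<in> K" for x
  proof (rule onorm_le)
    fix v
    interpret bounded_linear "?D x" using d by (rule has_derivative_bounded_linear)
    have "?D x v = ?D x (\<Sum>i\<in>Basis. (v \<bullet> i) *\<^sub>R i)" by (simp add: euclidean_representation)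
    also have "\<dots> = (\<Sum>i\<in>Basis. (v \<bullet> i) *\<^sub>R ?D x i)" by (simp add: sum scaleR)
    also have "norm \<dots> \<le> (\<Sum>i\<in>Basis. norm v * B i)"
      by (intro sum_norm_le) (simp add: mult_mono Basis_le_norm B[OF that])
    also have "\<dots> = (\<Sum>i\<in>Basis. B i) * norm v" by (simp add: sum_distrib_left mult.commute)
    also have "\<dots> \<le> L * norm v" by (intro mult_right_mono) (auto simp: L_def)
    finally show "norm (?D x v) \<le> L * norm v" .
  qed
  then have "norm (g x - g y) \<le> L * norm (x - y)" if "x \<in> K" "y \<in> K" for x y
    using that d assms(3) by (intro differentiable_bound[of K g ?D]) (auto intro: has_derivative_at_withinI)
  then show thesis by (intro that[of L]) (auto simp: L_def)
qed

section \<open>Projection onto two half spaces depending on a parameter\<close>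

text \<open>The feasible set of the quadratic program has this form at every state. Both constraints are kept affine,
  rather than normalized, because their data vary continuously with the state.\<close>

definition halfspace_pair :: "'b::euclidean_space \<Rightarrow> real \<Rightarrow> 'b \<Rightarrow> real \<Rightarrow> 'b set" where
  "halfspace_pair a s a' s' = {q. a \<bullet> q + s \<ge> 0 \<and> a' \<bullet> q + s' \<ge> 0}"

lemma closed_halfspace_pair: "closed (halfspace_pair a s a' s')"
  and convex_halfspace_pair: "convex (halfspace_pair a s a' s')"
proof -
  have "halfspace_pair a s a' s' = {q. a \<bullet> q \<ge> - s} \<inter> {q. a' \<bullet> q \<ge> - s'}"
    unfolding halfspace_pair_def by auto
  then show "closed (halfspace_pair a s a' s')" "convex (halfspace_pair a s a' s')"
    by (auto intro: closed_Int closed_halfspace_ge convex_Int convex_halfspace_ge)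
qed

lemma halfspace_perturb:
  fixes a :: "'z::t2_space \<Rightarrow> 'b::euclidean_space"
  assumes "isCont a z0" "isCont s z0" "m > 0"
  shows "eventually (\<lambda>z. \<forall>q. norm q \<le> R \<longrightarrow> \<bar>(a z \<bullet> q + s z) - (a z0 \<bullet> q + s z0)\<bar> < m) (nhds z0)"
proof -
  define R' where "R' = max R 1"
  have R': "R' > 0" "R \<le> R'" by (auto simp: R'_def)
  have "eventually (\<lambda>z. dist (a z) (a z0) < m / (2 * R')) (nhds z0)"
    using assms R' by (intro tendstoD) (auto simp: isCont_def tendsto_at_iff_tendsto_nhds)
  moreover have "eventually (\<lambda>z. dist (s z) (s z0) < m / 2) (nhds z0)"
    using assms by (intro tendstoD) (auto simp: isCont_def tendsto_at_iff_tendsto_nhds)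
  ultimately show ?thesis
  proof eventually_elim
    case (elim z)
    show ?case
    proof (intro allI impI)
      fix q :: 'b assume q: "norm q \<le> R"
      have "\<bar>(a z - a z0) \<bullet> q\<bar> \<le> norm (a z - a z0) * norm q" by (rule Cauchy_Schwarz_ineq2)
      also have "\<dots> \<le> m / (2 * R') * R'" using elim q R' assms(3) by (intro mult_mono) (auto simp: dist_norm less_imp_le)
      finally have "\<bar>(a z - a z0) \<bullet> q\<bar> \<le> m / 2" using R' by simp
      moreover have "\<bar>s z - s z0\<bar> < m / 2" using elim by (simp add: dist_real_def)
      ultimately show "\<bar>(a z \<bullet> q + s z) - (a z0 \<bullet> q + s z0)\<bar> < m"
        unfolding inner_diff_left by linarith
    qed
  qed
qed

text \<open>Mixing in a strictly feasible point \<open>q\<close> repairs a violation that is small relative to its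
  weight \<open>t\<close>.\<close>

lemma slater_mix:
  assumes "a \<bullet> p + s \<ge> - (t * m / 2)" "a \<bullet> q + s \<ge> m" "0 < t" "t \<le> 1" "m > (0::real)"
  shows "a \<bullet> ((1 - t) *\<^sub>R p + t *\<^sub>R q) + s \<ge> t * m / 2"
proof -
  have "(1 - t) * (a \<bullet> p + s) \<ge> - (t * m / 2)"
  proof -
    have "(1 - t) * (a \<bullet> p + s) \<ge> (1 - t) * (- (t * m / 2))"
      using assms by (intro mult_left_mono) auto
    moreover have "(1 - t) * (t * m / 2) \<le> 1 * (t * m / 2)"
      using assms by (intro mult_right_mono) auto
    ultimately show ?thesis by linarith
  qed
  moreover have "t * (a \<bullet> q + s) \<ge> t * m" using assms by (intro mult_left_mono) auto
  ultimately show ?thesis by (simp add: inner_add_right algebra_simps)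
qed

text \<open>Continuity in the parameter under Slater's condition. Mixing a projection with the strictly feasible \<open>q0\<close>
  moves it only slightly and makes it feasible for all nearby parameters. Thus the projection at
  \<open>z0\<close> is nearly a competitor at \<open>z\<close> and conversely; adding the two variational inequalities bounds the
  squared distance of the two projections.\<close>

lemma projection_continuous:
  fixes a a' :: "'z::t2_space \<Rightarrow> 'b::euclidean_space"
  assumes cont: "isCont a z0" "isCont s z0" "isCont a' z0" "isCont s' z0" "isCont T z0"
    and slater: "a z0 \<bullet> q0 + s z0 > 0" "a' z0 \<bullet> q0 + s' z0 > 0"
  shows "isCont (\<lambda>z. closest_point (halfspace_pair (a z) (s z) (a' z) (s' z)) (T z)) z0"
proof -
  let ?P = "\<lambda>z. halfspace_pair (a z) (s z) (a' z) (s' z)"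
  define m where "m = min (a z0 \<bullet> q0 + s z0) (a' z0 \<bullet> q0 + s' z0)"
  have m: "m > 0" "a z0 \<bullet> q0 + s z0 \<ge> m" "a' z0 \<bullet> q0 + s' z0 \<ge> m"
    using slater by (auto simp: m_def)
  define R where "R = norm (T z0) + norm (T z0 - q0) + norm q0 + 1"
  have R: "R \<ge> 1" "norm (T z0 - q0) \<le> R" "norm q0 \<le> R" by (auto simp: R_def)
  \<comment> \<open>First vary only the polyhedron: projections are nonexpansive in the projected point.\<close>
  have fixT: "eventually (\<lambda>z. q0 \<in> ?P z \<and> dist (closest_point (?P z) (T z0)) (closest_point (?P z0) (T z0)) < e)
      (nhds z0)" if e: "e > 0" for e
  proof -
    define t where "t = min 1 (e\<^sup>2 / (8 * R\<^sup>2))"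
    have t: "0 < t" "t \<le> 1" "t * (4 * R\<^sup>2) < e\<^sup>2"
    proof -
      have "t * (4 * R\<^sup>2) \<le> e\<^sup>2 / (8 * R\<^sup>2) * (4 * R\<^sup>2)" by (intro mult_right_mono) (auto simp: t_def)
      also have "\<dots> = e\<^sup>2 / 2" using R by (simp add: field_simps)
      also have "\<dots> < e\<^sup>2" using e by simp
      finally show "t * (4 * R\<^sup>2) < e\<^sup>2" .
    qed (use e R in \<open>auto simp: t_def\<close>)
    have "eventually (\<lambda>z. \<forall>q. norm q \<le> R \<longrightarrow> \<bar>(a z \<bullet> q + s z) - (a z0 \<bullet> q + s z0)\<bar> < t * m / 2) (nhds z0)"
      using cont t m by (intro halfspace_perturb) auto
    moreover have "eventually (\<lambda>z. \<forall>q. norm q \<le> R \<longrightarrow> \<bar>(a' z \<bullet> q + s' z) - (a' z0 \<bullet> q + s' z0)\<bar> < t * m / 2) (nhds z0)"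
      using cont t m by (intro halfspace_perturb) auto
    ultimately show ?thesis
    proof eventually_elim
      case (elim z)
      let ?pa = "closest_point (?P z0) (T z0)" and ?p = "closest_point (?P z) (T z0)"
      let ?T = "T z0"
      have tm: "t * m / 2 \<le> m"
      proof -
        have "t * m \<le> 1 * m" using t m by (intro mult_right_mono) auto
        then show ?thesis using m by simp
      qed
      have q0: "q0 \<in> ?P z" "q0 \<in> ?P z0"
        using elim[rule_format, OF R(3)] m tm unfolding halfspace_pair_def mem_Collect_eq by linarith+
      have in0: "?pa \<in> ?P z0" and inz: "?p \<in> ?P z"
        using closest_point_in_set[OF closed_halfspace_pair] q0 by blast+
      have d0: "norm (?T - ?pa) \<le> norm (?T - q0)" "norm (?T - ?p) \<le> norm (?T - q0)"
        using closest_point_le[OF closed_halfspace_pair q0(2), of ?T] closest_point_le[OF closed_halfspace_pair q0(1), of ?T]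
        by (auto simp: dist_norm)
      have bd: "norm ?pa \<le> R" "norm ?p \<le> R"
        using d0 norm_triangle_ineq2[of ?pa ?T] norm_triangle_ineq2[of ?p ?T] norm_ge_zero[of q0]
        unfolding R_def norm_minus_commute[of ?pa ?T] norm_minus_commute[of ?p ?T] by linarith+
      let ?qa = "(1 - t) *\<^sub>R ?pa + t *\<^sub>R q0" and ?qb = "(1 - t) *\<^sub>R ?p + t *\<^sub>R q0"
      have bq: "norm ?qa \<le> R"
      proof -
        have "norm ?qa \<le> (1 - t) * norm ?pa + t * norm q0"
          using t by (intro order_trans[OF norm_triangle_ineq]) simp
        also have "\<dots> \<le> (1 - t) * R + t * R" using bd R t by (intro add_mono mult_left_mono) auto
        finally show ?thesis by (simp add: algebra_simps)
      qed
      have "a z0 \<bullet> ?qa + s z0 \<ge> t * m / 2" "a' z0 \<bullet> ?qa + s' z0 \<ge> t * m / 2"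
      proof -
        have "a z0 \<bullet> ?pa + s z0 \<ge> 0" "a' z0 \<bullet> ?pa + s' z0 \<ge> 0" "t * m / 2 \<ge> 0"
          using in0 m t unfolding halfspace_pair_def by auto
        then show "a z0 \<bullet> ?qa + s z0 \<ge> t * m / 2" "a' z0 \<bullet> ?qa + s' z0 \<ge> t * m / 2"
          using m t by (intro slater_mix; linarith)+
      qed
      then have q1: "?qa \<in> ?P z" using elim bq unfolding halfspace_pair_def by (smt (verit) mem_Collect_eq)
      have "a z0 \<bullet> ?p + s z0 \<ge> - (t * m / 2)" "a' z0 \<bullet> ?p + s' z0 \<ge> - (t * m / 2)"
        using elim bd inz unfolding halfspace_pair_def by (smt (verit) mem_Collect_eq)+
      then have "a z0 \<bullet> ?qb + s z0 \<ge> t * m / 2" "a' z0 \<bullet> ?qb + s' z0 \<ge> t * m / 2"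
        using m t by (intro slater_mix; linarith)+
      moreover have "t * m / 2 > 0" using t m by simp
      ultimately have q2: "?qb \<in> ?P z0" unfolding halfspace_pair_def by simp
      have near: "norm (p - ((1 - t) *\<^sub>R p + t *\<^sub>R q0)) \<le> t * (2 * R)" if "norm p \<le> R" for p
      proof -
        have "p - ((1 - t) *\<^sub>R p + t *\<^sub>R q0) = t *\<^sub>R (p - q0)" by (simp add: algebra_simps)
        moreover have "norm (p - q0) \<le> 2 * R"
          using that R norm_triangle_ineq4[of p q0] by simp
        ultimately show ?thesis using t by (simp add: mult_left_mono)
      qed
      have dot: "v \<bullet> x \<le> R * (t * (2 * R))" if "norm v \<le> R" "norm x \<le> t * (2 * R)" for v x :: 'b
      proof -
        have "v \<bullet> x \<le> norm v * norm x" by (rule norm_cauchy_schwarz)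
        also have "\<dots> \<le> R * (t * (2 * R))" using that R by (intro mult_mono) auto
        finally show ?thesis .
      qed
      have "(?T - ?pa) \<bullet> (?qb - ?pa) \<le> 0" "(?T - ?p) \<bullet> (?qa - ?p) \<le> 0"
        using q1 q2 by (auto intro!: closest_point_dot closed_halfspace_pair convex_halfspace_pair)
      moreover have "(?T - ?pa) \<bullet> (?p - ?qb) \<le> R * (t * (2 * R))" "(?T - ?p) \<bullet> (?pa - ?qa) \<le> R * (t * (2 * R))"
        using d0 R bd near by (auto intro!: dot)
      moreover have "(norm (?p - ?pa))\<^sup>2 = (?T - ?pa) \<bullet> (?qb - ?pa) + (?T - ?pa) \<bullet> (?p - ?qb) + (?T - ?p) \<bullet> (?qa - ?p)
          + (?T - ?p) \<bullet> (?pa - ?qa)"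
        by (simp add: power2_norm_eq_inner algebra_simps inner_commute)
      moreover have "t * (4 * R\<^sup>2) = R * (t * (2 * R)) + R * (t * (2 * R))" by (simp add: power2_eq_square)
      ultimately have "(norm (?p - ?pa))\<^sup>2 \<le> t * (4 * R\<^sup>2)" by linarith
      also note t(3)
      finally have "norm (?p - ?pa) < e" using e by (rule_tac power2_less_imp_less) auto
      then show ?case using q0 by (simp add: dist_norm)
    qed
  qed
  let ?g = "\<lambda>z. closest_point (?P z) (T z)"
  have "eventually (\<lambda>z. dist (?g z) (?g z0) < e) (nhds z0)" if e: "e > 0" for e
  proof -
    have "eventually (\<lambda>z. dist (T z) (T z0) < e / 2) (nhds z0)"
      using cont e by (intro tendstoD) (auto simp: isCont_def tendsto_at_iff_tendsto_nhds)
    moreover have "eventually (\<lambda>z. q0 \<in> ?P z \<and>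
        dist (closest_point (?P z) (T z0)) (closest_point (?P z0) (T z0)) < e / 2) (nhds z0)"
      using e by (intro fixT) auto
    ultimately show ?thesis
    proof eventually_elim
      case (elim z)
      have "dist (closest_point (?P z) (T z)) (closest_point (?P z) (T z0)) \<le> dist (T z) (T z0)"
        using elim by (intro closest_point_lipschitz closed_halfspace_pair convex_halfspace_pair) auto
      then show ?case using elim
          dist_triangle[of "closest_point (?P z) (T z)" "closest_point (?P z0) (T z0)" "closest_point (?P z) (T z0)"]
        by linarith
    qed
  qed
  then have "(?g \<longlongrightarrow> ?g z0) (nhds z0)" by (rule tendstoI)
  then show ?thesis unfolding isCont_def by (rule tendsto_at_iff_tendsto_nhds[THEN iffD2])
qed

section \<open>Existence, continuation and stability of solutions on a compact invariant set\<close>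

lemma integral_upper_lipschitz:
  fixes \<phi> :: "real \<Rightarrow> 'a::banach"
  assumes c: "continuous_on UNIV \<phi>" and M: "\<And>s. norm (\<phi> s) \<le> M"
  shows "norm (integral {0..t} \<phi> - integral {0..s} \<phi>) \<le> M * \<bar>t - s\<bar>"
proof -
  have cc: "continuous_on S \<phi>" for S using c continuous_on_subset by blast
  have M0: "M \<ge> 0" using order_trans[OF norm_ge_zero M[of 0]] .
  have *: "norm (integral {0..t} \<phi> - integral {0..s} \<phi>) \<le> M * (t - s)" if "s \<le> t" for s t
  proof (cases "s \<le> 0")
    case True
    then have s: "integral {0..s} \<phi> = 0" by (cases "s = 0") auto
    show ?thesis
    proof (cases "t \<le> 0")
      case True
      then have "integral {0..t} \<phi> = 0" by (cases "t = 0") auto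
      then show ?thesis using s that M0 by simp
    next
      case False
      then have "norm (integral {0..t} \<phi>) \<le> M * (t - 0)"
        using M by (intro integral_bound cc) auto
      also have "\<dots> \<le> M * (t - s)" using True M0 by (intro mult_left_mono) auto
      finally show ?thesis using s by simp
    qed
  next
    case False
    have "integral {0..s} \<phi> + integral {s..t} \<phi> = integral {0..t} \<phi>"
      using False that by (intro Henstock_Kurzweil_Integration.integral_combine integrable_continuous_real cc) auto
    then have "integral {0..t} \<phi> - integral {0..s} \<phi> = integral {s..t} \<phi>" by (simp add: algebra_simps)
    then show ?thesis using integral_bound[OF that cc, of M] M by simp
  qed
  show ?thesis
    using *[of s t] *[of t s] by (cases "s \<le> t") (auto simp: norm_minus_commute)
qed

text \<open>Peano's theorem for bounded fields, by Tonelli's method of delays. With a delay of \<open>h\<close> the integral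
  equation is solved by iteration, because the \<open>j\<close>-th iterate is already final up to time \<open>j h\<close>. The
  delayed solutions are equi-Lipschitz, and a uniform limit for \<open>h \<rightarrow> 0\<close> solves the equation without
  delay.\<close>

lemma peano_bounded:
  fixes F :: "'a::euclidean_space \<Rightarrow> 'a"
  assumes c: "continuous_on UNIV F" and M: "\<And>x. norm (F x) \<le> M"
  shows "\<exists>z. z 0 = z0 \<and> solution F UNIV {0..1} z"
proof -
  have M0: "M \<ge> 0" using order_trans[OF norm_ge_zero M[of 0]] .
  define Y where "Y h = rec_nat (\<lambda>t. z0) (\<lambda>j y t. z0 + integral {0..t} (\<lambda>s. F (y (s - h))))" for h :: real
  \<comment> \<open>For negative times the integral is over an empty interval, so every iterate equals \<open>z0\<close> there.\<close>
  have Y0: "Y h 0 t = z0" and YS: "Y h (Suc j) t = z0 + integral {0..t} (\<lambda>s. F (Y h j (s - h)))" for h j t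
    by (auto simp: Y_def)
  have Yc: "continuous_on UNIV (Y h j) \<and> (\<forall>s t. norm (Y h j t - Y h j s) \<le> M * \<bar>t - s\<bar>)" for h j
  proof (induction j)
    case 0
    then show ?case using M0 by (simp add: Y0[abs_def])
  next
    case (Suc j)
    have cc: "continuous_on UNIV (\<lambda>s. F (Y h j (s - h)))"
      by (rule continuous_on_compose2[OF c continuous_on_compose2[OF conjunct1[OF Suc]]])
         (auto intro!: continuous_intros)
    then have L: "norm (Y h (Suc j) t - Y h (Suc j) s) \<le> M * \<bar>t - s\<bar>" for s t
      using integral_upper_lipschitz[OF cc, of M t s] M by (simp add: YS)
    then have "M-lipschitz_on UNIV (Y h (Suc j))"
      using M0 by (intro lipschitz_onI) (auto simp: dist_norm)
    with L show ?case by (auto intro: lipschitz_on_continuous_on)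
  qed
  have stable: "t \<le> real j * h \<Longrightarrow> Y h (Suc j) t = Y h j t" for h j t
  proof (induction j arbitrary: t)
    case 0
    then show ?case by (cases "t = 0") (auto simp: YS Y0)
  next
    case (Suc j)
    have "integral {0..t} (\<lambda>s. F (Y h (Suc j) (s - h))) = integral {0..t} (\<lambda>s. F (Y h j (s - h)))"
      using Suc.prems by (intro integral_cong arg_cong[where f = F] Suc.IH) (auto simp: algebra_simps)
    then show ?case by (simp only: YS[of h "Suc j"] YS[of h j])
  qed
  define h where "h n = 1 / real (Suc n)" for n
  define y where "y n = Y (h n) (Suc n)" for n
  have yint: "y n t = z0 + integral {0..t} (\<lambda>s. F (y n (s - h n)))" if "t \<le> 1" for n t
  proof -
    have "y n t = Y (h n) (Suc (Suc n)) t"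
      unfolding y_def using that by (intro stable[symmetric]) (auto simp: h_def)
    then show ?thesis by (simp only: YS[of _ "Suc n"] y_def)
  qed
  have yL: "norm (y n t - y n s) \<le> M * \<bar>t - s\<bar>" for n s t using Yc by (auto simp: y_def)
  have yc: "continuous_on UNIV (y n)" for n using Yc by (auto simp: y_def)
  have y0: "y n 0 = z0" for n using yint[of 0 n] by simp
  have bd: "norm (y n t) \<le> norm z0 + M" if "t \<in> {0..1}" for n t
  proof -
    have "norm (y n t - y n 0) \<le> M * \<bar>t - 0\<bar>" by (rule yL)
    also have "\<dots> \<le> M * 1" using that M0 by (intro mult_left_mono) auto
    finally show ?thesis using y0 norm_triangle_sub[of "y n t" z0] by simp
  qed
  obtain g k where g: "continuous_on {0..1} g" and k: "strict_mono (k :: nat \<Rightarrow> nat)"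
    and lim: "\<And>e. 0 < e \<Longrightarrow> \<exists>N. \<forall>n x. n \<ge> N \<and> x \<in> {0..1} \<longrightarrow> norm (y (k n) x - g x) < e"
  proof (rule Arzela_Ascoli[of "{0..1::real}" y "norm z0 + M"])
    fix x e :: real assume "x \<in> {0..1}" "0 < e"
    have "norm (y n x - y n t) < e" if "norm (x - t) < e / (M + 1)" for n t
    proof -
      have "norm (y n x - y n t) \<le> M * \<bar>x - t\<bar>" by (rule yL)
      also have "\<dots> \<le> (M + 1) * \<bar>x - t\<bar>" by (intro mult_right_mono) auto
      also have "\<dots> < e" using that M0 by (simp add: field_simps)
      finally show ?thesis .
    qed
    then show "\<exists>d>0. \<forall>n t. t \<in> {0..1} \<and> norm (x - t) < d \<longrightarrow> norm (y n x - y n t) < e"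
      using \<open>0 < e\<close> M0 by (intro exI[of _ "e / (M + 1)"]) auto
  qed (use bd in auto)
  have ptw: "(\<lambda>n. y (k n) t) \<longlonglongrightarrow> g t" if "t \<in> {0..1}" for t
    unfolding LIMSEQ_iff using lim that by blast
  have hk: "(\<lambda>n. h (k n)) \<longlonglongrightarrow> 0"
    using LIMSEQ_subseq_LIMSEQ[OF LIMSEQ_inverse_real_of_nat k] by (simp add: h_def o_def inverse_eq_divide)
  have delayed: "(\<lambda>n. y (k n) (t - h (k n))) \<longlonglongrightarrow> g t" if "t \<in> {0..1}" for t
  proof -
    have "(\<lambda>n. y (k n) (t - h (k n)) - y (k n) t) \<longlonglongrightarrow> 0"
    proof (rule Lim_null_comparison)
      show "(\<lambda>n. M * \<bar>h (k n)\<bar>) \<longlonglongrightarrow> 0" using tendsto_mult_right_zero[OF tendsto_rabs_zero[OF hk]] .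
      show "\<forall>\<^sub>F n in sequentially. norm (y (k n) (t - h (k n)) - y (k n) t) \<le> M * \<bar>h (k n)\<bar>"
      proof (intro always_eventually allI)
        fix n
        have "norm (y (k n) (t - h (k n)) - y (k n) t) \<le> M * \<bar>(t - h (k n)) - t\<bar>" by (rule yL)
        then show "norm (y (k n) (t - h (k n)) - y (k n) t) \<le> M * \<bar>h (k n)\<bar>" by simp
      qed
    qed
    from tendsto_add[OF this ptw[OF that]] show ?thesis by simp
  qed
  have gint: "g t = z0 + integral {0..t} (\<lambda>s. F (g s))" if t: "t \<in> {0..1}" for t
  proof -
    have "(\<lambda>n. integral {0..t} (\<lambda>s. F (y (k n) (s - h (k n))))) \<longlonglongrightarrow> integral {0..t} (\<lambda>s. F (g s))"
    proof (rule dominated_convergence(2)[where h = "\<lambda>_. M"])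
      show "(\<lambda>s. F (y (k n) (s - h (k n)))) integrable_on {0..t}" for n
      proof (rule integrable_continuous_real)
        have "continuous_on UNIV (\<lambda>s. F (y (k n) (s - h (k n))))"
          by (rule continuous_on_compose2[OF c continuous_on_compose2[OF yc]])
             (auto intro!: continuous_intros)
        then show "continuous_on {0..t} (\<lambda>s. F (y (k n) (s - h (k n))))" by (rule continuous_on_subset) simp
      qed
      show "(\<lambda>n. F (y (k n) (s - h (k n)))) \<longlonglongrightarrow> F (g s)" if "s \<in> {0..t}" for s
        using t that c by (intro continuous_on_tendsto_compose[OF c] delayed) auto
    qed (use M in auto)
    then have "(\<lambda>n. z0 + integral {0..t} (\<lambda>s. F (y (k n) (s - h (k n))))) \<longlonglongrightarrow> z0 + integral {0..t} (\<lambda>s. F (g s))"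
      by (intro tendsto_intros)
    moreover have "(\<lambda>n. z0 + integral {0..t} (\<lambda>s. F (y (k n) (s - h (k n))))) = (\<lambda>n. y (k n) t)"
      using t yint[of t] by auto
    ultimately show ?thesis using LIMSEQ_unique ptw[OF t] by metis
  qed
  have Fg: "continuous_on {0..1} (\<lambda>s. F (g s))" by (rule continuous_on_compose2[OF c g]) simp
  have "(g has_vector_derivative F (g t)) (at t within {0..1})" if t: "t \<in> {0..1}" for t
  proof (rule has_vector_derivative_transform[OF t])
    show "((\<lambda>t. z0 + integral {0..t} (\<lambda>s. F (g s))) has_vector_derivative F (g t)) (at t within {0..1})"
      using integral_has_vector_derivative[OF Fg t] by (auto intro!: derivative_eq_intros)
  qed (rule gint)
  moreover have "g 0 = z0" using gint[of 0] by simp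
  ultimately show ?thesis by (auto simp: solution_def)
qed

lemma solution_subset: "solution F D J z \<Longrightarrow> J' \<subseteq> J \<Longrightarrow> solution F D J' z"
  unfolding solution_def using has_vector_derivative_within_subset by blast

text \<open>Being a solution is a local property in time; \<open>J\<close> and \<open>J'\<close> need only agree near each point.\<close>

lemma solution_local:
  assumes "\<And>t. t \<in> J \<Longrightarrow> \<exists>S J' y. open S \<and> t \<in> S \<and> t \<in> J' \<and> J \<inter> S = J' \<inter> S \<and> solution F D J' y \<and> (\<forall>s\<in>J\<inter>S. z s = y s)"
  shows "solution F D J z"
  unfolding solution_def
proof
  fix t assume t: "t \<in> J"
  obtain S J' y where S: "open S" "t \<in> S" "t \<in> J'" "J \<inter> S = J' \<inter> S" and y: "solution F D J' y" "\<forall>s\<in>J\<inter>S. z s = y s"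
    using assms[OF t] by metis
  have zy: "z t = y t" using S t y by auto
  have "(y has_vector_derivative F (y t)) (at t within J' \<inter> S)"
    using y(1) S(3) has_vector_derivative_within_subset unfolding solution_def by blast
  then have "(z has_vector_derivative F (z t)) (at t within J \<inter> S)"
    unfolding zy using S t y(2) by (intro has_vector_derivative_transform[of t "J \<inter> S" z y]) auto
  moreover have "at t within J \<inter> S = at t within J"
    using S by (intro at_within_nhd[of t S]) auto
  moreover have "z t \<in> D" using y(1) S(3) zy by (simp add: solution_def)
  ultimately show "z t \<in> D \<and> (z has_vector_derivative F (z t)) (at t within J)" by simp
qed

lemma solution_glue:
  assumes y: "solution F D {0..T} y" and x: "solution F D J x"
    and J: "0 \<in> J" "J \<subseteq> {0..}" and T: "T \<ge> 0" and xy: "x 0 = y T"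
  shows "solution F D ({0..T} \<union> (+) T ` J) (\<lambda>t. if t \<in> {0..T} then y t else x (t - T))"
  unfolding solution_def
proof
  let ?J = "(+) T ` J"
  fix t assume t: "t \<in> {0..T} \<union> ?J"
  have TJ: "T \<in> ?J" using J by force
  have "closure ?J \<subseteq> {T..}" using J by (intro closure_minimal) auto
  then have cl: "closure {0..T} \<inter> closure ?J = {T}"
    using TJ T closure_subset[of ?J] by auto
  have dx: "((\<lambda>t. x (t - T)) has_vector_derivative F (x (s - T))) (at s within ?J)" if "s \<in> ?J" for s
  proof -
    have "(x has_vector_derivative F (x (s - T))) (at (s - T) within (\<lambda>t. t - T) ` ?J)"
      using x that by (auto simp: solution_def image_image)
    moreover have "((\<lambda>t. t - T) has_vector_derivative 1) (at s within ?J)"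
      by (auto intro!: derivative_eq_intros)
    ultimately show ?thesis using vector_diff_chain_within[of "\<lambda>t. t - T" 1 s ?J x] by (simp add: o_def)
  qed
  have "((\<lambda>t. if t \<in> {0..T} then y t else x (t - T)) has_vector_derivative
      (if t \<in> {0..T} then F (y t) else F (x (t - T)))) (at t within {0..T} \<union> ?J)"
  proof (rule has_vector_derivative_If_within_closures)
    show "(y has_vector_derivative F (y t)) (at t within {0..T} \<union> (closure {0..T} \<inter> closure ?J))"
      if "t \<in> {0..T} \<union> (closure {0..T} \<inter> closure ?J)"
      using that y T unfolding cl solution_def by (auto simp: insert_absorb)
    show "((\<lambda>t. x (t - T)) has_vector_derivative F (x (t - T))) (at t within ?J \<union> (closure {0..T} \<inter> closure ?J))"
      if "t \<in> ?J \<union> (closure {0..T} \<inter> closure ?J)"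
      using that dx[of t] TJ unfolding cl by (auto simp: insert_absorb)
    show "y t = x (t - T)" "F (y t) = F (x (t - T))" if "t \<in> closure {0..T}" "t \<in> closure ?J"
    proof -
      have "t = T" using cl that by blast
      then show "y t = x (t - T)" "F (y t) = F (x (t - T))" using xy by auto
    qed
  qed (use t in auto)
  moreover have "(if t \<in> {0..T} then y t else x (t - T)) \<in> D"
    using t x y by (auto simp: solution_def)
  ultimately show "(if t \<in> {0..T} then y t else x (t - T)) \<in> D \<and>
      ((\<lambda>t. if t \<in> {0..T} then y t else x (t - T)) has_vector_derivative
       F (if t \<in> {0..T} then y t else x (t - T))) (at t within {0..T} \<union> ?J)"
    by (simp add: if_distrib[of F])
qed

text \<open>Stated for solutions on compact time intervals, which gives invariance also for half-open and unbounded
  ones by restriction.\<close>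

definition forward_invariant :: "('a::real_normed_vector \<Rightarrow> 'a) \<Rightarrow> 'a set \<Rightarrow> 'a set \<Rightarrow> bool" where
  "forward_invariant F D I \<longleftrightarrow>
     (\<forall>T\<ge>0. \<forall>z. solution F D {0..T} z \<and> z 0 \<in> I \<longrightarrow> z T \<in> I)"

lemma forward_invariantD:
  "forward_invariant F D I \<Longrightarrow> 0 \<le> T \<Longrightarrow> solution F D {0..T} z \<Longrightarrow> z 0 \<in> I \<Longrightarrow> z T \<in> I"
  by (simp add: forward_invariant_def)

text \<open>Restrict the field to a compact neighbourhood of \<open>I\<close>, extend it to a bounded continuous field on the whole
  space, and stop the resulting solution before it can leave the neighbourhood. The speed bound makes the
  stopping time the same for all initial points.\<close>

lemma local_solutions:
  fixes F :: "'a::euclidean_space \<Rightarrow> 'a"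
  assumes "compact I" "open U" "I \<subseteq> U" "continuous_on U F"
  obtains \<tau> where "\<tau> > 0" "\<And>z0. z0 \<in> I \<Longrightarrow> \<exists>z. z 0 = z0 \<and> solution F U {0..\<tau>} z"
proof (cases "I = {}")
  case False
  obtain e where e: "e > 0" "{x. infdist x I \<le> e} \<subseteq> U"
    using compact_in_open_separated[OF False assms(1-3)] by blast
  let ?N = "{x. infdist x I \<le> e}"
  have N: "compact ?N" using False assms(1) e by (intro compact_infdist_le)
  have cN: "continuous_on ?N F" using assms(4) e(2) continuous_on_subset by blast
  obtain B where B: "\<And>x. x \<in> ?N \<Longrightarrow> norm (F x) \<le> B"
    using compact_imp_bounded[OF compact_continuous_image[OF cN N]] by (auto simp: bounded_iff)
  define M where "M = max B 1"
  have M: "M > 0" "\<And>x. x \<in> ?N \<Longrightarrow> norm (F x) \<le> M" using B unfolding M_def by (auto simp: le_max_iff_disj)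
  obtain G where G: "continuous_on UNIV G" "G ` UNIV \<subseteq> cball 0 M" "\<And>x. x \<in> ?N \<Longrightarrow> G x = F x"
  proof (rule Dugundji[of "cball (0::'a) M" UNIV ?N F])
    show "closedin (top_of_set UNIV) ?N" using N compact_imp_closed by auto
    show "F ` ?N \<subseteq> cball 0 M" using M by auto
  qed (use cN M in auto)
  define \<tau> where "\<tau> = min 1 (e / M)"
  have "\<exists>z. z 0 = z0 \<and> solution F U {0..\<tau>} z" if z0: "z0 \<in> I" for z0
  proof -
    obtain z where z: "z 0 = z0" "solution G UNIV {0..1} z"
      using peano_bounded[OF G(1), of M z0] G(2) by (auto simp: image_subset_iff)
    have "z t \<in> ?N" if t: "t \<in> {0..\<tau>}" for t
    proof -
      have "norm (z t - z 0) \<le> M * norm (t - 0)"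
      proof (rule differentiable_bound[of "{0..1}" z "\<lambda>s h. h *\<^sub>R G (z s)"])
        show "(z has_derivative (\<lambda>h. h *\<^sub>R G (z s))) (at s within {0..1})" if "s \<in> {0..1}" for s
          using z(2) that by (auto simp: solution_def has_vector_derivative_def)
        show "onorm (\<lambda>h. h *\<^sub>R G (z s)) \<le> M" for s
          using G(2) by (intro onorm_le) (auto simp: mult.commute[of M] image_subset_iff intro!: mult_left_mono)
      qed (use t in \<open>auto simp: \<tau>_def\<close>)
      also have "\<dots> \<le> M * (e / M)" using t M by (intro mult_left_mono) (auto simp: \<tau>_def)
      finally show ?thesis using z(1) M z0 by (auto intro!: infdist_le2 simp: dist_norm)
    qed
    then have "solution F U {0..\<tau>} z"
      using solution_subset[OF z(2), of "{0..\<tau>}"] e(2) G(3) by (auto simp: solution_def \<tau>_def)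
    with z show ?thesis by blast
  qed
  then show thesis using that[of \<tau>] e M by (auto simp: \<tau>_def)
qed (use that[of 1] in auto)

text \<open>Invariance brings the end point of each local solution back into \<open>I\<close>, where the next one of the
  same length starts.\<close>

lemma global_solutions:
  fixes F :: "'a::euclidean_space \<Rightarrow> 'a"
  assumes "compact I" "open U" "I \<subseteq> U" "U \<subseteq> D" "continuous_on U F"
    and inv: "forward_invariant F D I"
    and z0: "z0 \<in> I"
  shows "\<exists>z. solution F D {0..} z \<and> z 0 = z0"
proof -
  obtain \<tau> where \<tau>: "\<tau> > 0" and loc: "\<And>z0. z0 \<in> I \<Longrightarrow> \<exists>z. z 0 = z0 \<and> solution F U {0..\<tau>} z"
    using local_solutions[OF assms(1,2,3,5)] by blast
  define P where "P n z \<longleftrightarrow> solution F D {0..real n * \<tau>} z \<and> z 0 = z0" for n :: nat and z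
  define Q where "Q n z z' \<longleftrightarrow> (\<forall>t\<in>{0..real n * \<tau>}. z' t = z t)" for n :: nat and z z' :: "real \<Rightarrow> 'a"
  have "\<exists>Z. \<forall>n. P n (Z n) \<and> Q n (Z n) (Z (Suc n))"
  proof (rule dependent_nat_choice)
    \<comment> \<open>On the degenerate interval \<open>{0}\<close> any vector is a derivative.\<close>
    have "at (0::real) within {0} = bot" by (simp add: at_within_def)
    then show "\<exists>z. P 0 z"
      using z0 assms(3,4) by (intro exI[of _ "\<lambda>t. z0"])
        (auto simp: P_def solution_def has_vector_derivative_def has_derivative_def bounded_linear_scaleR_left)
    fix z n assume z: "P n z"
    have "z (real n * \<tau>) \<in> I" using z \<tau> z0 by (rule_tac forward_invariantD[OF inv]) (auto simp: P_def)
    then obtain x where x: "x 0 = z (real n * \<tau>)" "solution F U {0..\<tau>} x" using loc by blast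
    have "solution F D {0..\<tau>} x" using x(2) assms(4) by (auto simp: solution_def)
    then have "solution F D ({0..real n * \<tau>} \<union> (+) (real n * \<tau>) ` {0..\<tau>}) (\<lambda>t. if t \<in> {0..real n * \<tau>} then z t else x (t - real n * \<tau>))"
      using z x \<tau> by (intro solution_glue) (auto simp: P_def)
    moreover have "{0..real n * \<tau>} \<union> (+) (real n * \<tau>) ` {0..\<tau>} = {0..real (Suc n) * \<tau>}"
      using \<tau> mult_nonneg_nonneg[of "real n" \<tau>]
      by (auto simp: distrib_right ivl_disj_un image_add_atLeastAtMost)
    ultimately show "\<exists>z'. P (Suc n) z' \<and> Q n z z'"
      using z \<tau> by (intro exI[of _ "\<lambda>t. if t \<in> {0..real n * \<tau>} then z t else x (t - real n * \<tau>)"]) (auto simp: P_def Q_def)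
  qed
  then obtain Z where Z: "\<And>n. P n (Z n)" "\<And>n. Q n (Z n) (Z (Suc n))" by blast
  have agree: "Z n t = Z m t" if "m \<le> n" "0 \<le> t" "t \<le> real m * \<tau>" for m n t
    using that(1)
  proof (induction n rule: dec_induct)
    case (step n)
    have "real m * \<tau> \<le> real n * \<tau>" using step \<tau> by (intro mult_right_mono) auto
    then show ?case using Z(2)[of n] step that by (auto simp: Q_def)
  qed simp
  define N where "N t = nat \<lfloor>t / \<tau>\<rfloor> + 1" for t
  have N: "t < real (N t) * \<tau>" if "t \<ge> 0" for t
  proof -
    have "t / \<tau> < real (N t)" unfolding N_def using that \<tau> by (auto simp: of_nat_nat) linarith
    then show ?thesis using \<tau> by (simp add: field_simps)
  qed
  have same: "Z (N s) s = Z n s" if "0 \<le> s" "s \<le> real n * \<tau>" for n s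
    using that N[of s] agree[of n "N s" s] agree[of "N s" n s] by (cases "n \<le> N s") auto
  have "solution F D {0..} (\<lambda>t. Z (N t) t)"
  proof (rule solution_local)
    fix t :: real assume t: "t \<in> {0..}"
    show "\<exists>S J' y. open S \<and> t \<in> S \<and> t \<in> J' \<and> {0..} \<inter> S = J' \<inter> S \<and> solution F D J' y \<and>
        (\<forall>s\<in>{0..}\<inter>S. Z (N s) s = y s)"
      using t N[of t] Z(1)[of "N t"]
      by (intro exI[of _ "{..<real (N t) * \<tau>}"] exI[of _ "{0..real (N t) * \<tau>}"] exI[of _ "Z (N t)"])
         (auto simp: P_def intro!: same)
  qed
  moreover have "Z (N 0) 0 = z0" using Z(1) by (auto simp: P_def)
  ultimately show ?thesis by blast
qed

text \<open>A solution that stays in a compact set has bounded speed, hence a limit at the end of its interval. The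
  integral equation passes to the limit and supplies the one-sided derivative there, so that a
  global solution can be appended.\<close>

lemma continuation:
  fixes F :: "'a::euclidean_space \<Rightarrow> 'a"
  assumes "compact I" "open U" "I \<subseteq> U" "U \<subseteq> D" "continuous_on U F"
    and inv: "forward_invariant F D I"
    and y: "solution F D {0..<T} y" "y 0 \<in> I" and T: "T > 0"
  shows "\<exists>z. solution F D {0..} z \<and> (\<forall>t\<in>{0..<T}. z t = y t)"
proof -
  have cI: "continuous_on I F" using assms(3,5) continuous_on_subset by blast
  obtain B where B: "\<And>x. x \<in> I \<Longrightarrow> norm (F x) \<le> B"
    using compact_imp_bounded[OF compact_continuous_image[OF cI assms(1)]] by (auto simp: bounded_iff)
  have B0: "B \<ge> 0" using order_trans[OF norm_ge_zero B[OF y(2)]] .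
  have yI: "y t \<in> I" if "t \<in> {0..<T}" for t
    using that y(2) by (rule_tac forward_invariantD[OF inv _ solution_subset[OF y(1)]]) auto
  have "B-lipschitz_on {0..<T} y"
  proof (rule bounded_derivative_imp_lipschitz)
    show "(y has_derivative (\<lambda>h. h *\<^sub>R F (y s))) (at s within {0..<T})" if "s \<in> {0..<T}" for s
      using y(1) that by (auto simp: solution_def has_vector_derivative_def)
    show "onorm (\<lambda>h. h *\<^sub>R F (y s)) \<le> B" if "s \<in> {0..<T}" for s
      using B[OF yI[OF that]] by (intro onorm_le) (auto simp: mult.commute[of B] intro!: mult_left_mono)
  qed (use B0 in auto)
  from lipschitz_extend_closure[OF this] T
  obtain g where g: "B-lipschitz_on {0..T} g" "\<And>x. x \<in> {0..<T} \<Longrightarrow> g x = y x" by auto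
  have gc: "continuous_on {0..T} g" using g(1) by (rule lipschitz_on_continuous_on)
  have "g ` closure {0..<T} \<subseteq> I"
    using gc T yI g(2) assms(1) by (intro image_closure_subset) (auto simp: compact_imp_closed)
  then have gI: "g t \<in> I" if "t \<in> {0..T}" for t using that T by auto
  have Fg: "continuous_on {0..T} (\<lambda>t. F (g t))"
    using gI by (intro continuous_on_compose2[OF cI gc]) auto
  have dg: "(g has_vector_derivative F (g s)) (at s)" if "s \<in> {0<..<T}" for s
  proof -
    have "(y has_vector_derivative F (y s)) (at s within {0<..<T})"
      using that solution_subset[OF y(1), of "{0<..<T}"] by (simp add: solution_def subset_iff)
    then have "(y has_vector_derivative F (y s)) (at s)"
      using that by (simp add: has_vector_derivative_within_open[of s "{0<..<T}"])
    then have "(g has_vector_derivative F (y s)) (at s)"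
      by (rule has_vector_derivative_transform_within_open[of y _ s "{0<..<T}"]) (use that g(2) in auto)
    then show ?thesis using g(2)[of s] that by simp
  qed
  have gint: "g t = g 0 + integral {0..t} (\<lambda>s. F (g s))" if t: "t \<in> {0..T}" for t
  proof -
    have "((\<lambda>s. F (g s)) has_integral (g t - g 0)) {0..t}"
      using t dg continuous_on_subset[OF gc, of "{0..t}"] by (intro fundamental_theorem_of_calculus_interior) auto
    then show ?thesis by (simp add: integral_unique)
  qed
  have "(g has_vector_derivative F (g t)) (at t within {0..T})" if t: "t \<in> {0..T}" for t
  proof (rule has_vector_derivative_transform[OF t])
    show "((\<lambda>t. g 0 + integral {0..t} (\<lambda>s. F (g s))) has_vector_derivative F (g t)) (at t within {0..T})"
      using integral_has_vector_derivative[OF Fg t] by (auto intro!: derivative_eq_intros)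
  qed (rule gint)
  then have sg: "solution F D {0..T} g" using gI assms(3,4) unfolding solution_def by blast
  obtain x where x: "solution F D {0..} x" "x 0 = g T"
    using global_solutions[OF assms(1-6), of "g T"] gI[of T] T by auto
  have "solution F D ({0..T} \<union> (+) T ` {0..}) (\<lambda>t. if t \<in> {0..T} then g t else x (t - T))"
    using sg x T by (intro solution_glue) auto
  moreover have "{0..T} \<union> (+) T ` {0..} = {0..}" using T by (auto simp: image_add_atLeast)
  ultimately show ?thesis
    using g(2) by (intro exI[of _ "\<lambda>t. if t \<in> {0..T} then g t else x (t - T)"]) auto
qed

lemma solution_chain:
  assumes "solution F D J z" "t \<in> J" "(g has_derivative g') (at (z t))"
  shows "((\<lambda>s. g (z s)) has_real_derivative g' (F (z t))) (at t within J)"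
proof -
  have "(z has_derivative (\<lambda>h. h *\<^sub>R F (z t))) (at t within J)"
    using assms by (auto simp: solution_def has_vector_derivative_def)
  from has_derivative_compose[OF this assms(3)]
  have "((\<lambda>s. g (z s)) has_derivative (\<lambda>h. g' (h *\<^sub>R F (z t)))) (at t within J)" .
  moreover have "g' (h *\<^sub>R v) = h * g' v" for h v
    using linear_cmul[OF has_derivative_linear[OF assms(3)], of h v] by simp
  ultimately show ?thesis by (simp add: has_field_derivative_def mult_commute_abs)
qed

text \<open>The function \<open>t \<mapsto> \<phi> t exp (k t)\<close> is nondecreasing.\<close>

lemma nonneg_by_comparison:
  fixes \<phi> :: "real \<Rightarrow> real"
  assumes "T \<ge> 0" "\<phi> 0 \<ge> 0"
    and d: "\<And>t. t \<in> {0..T} \<Longrightarrow> (\<phi> has_real_derivative \<phi>' t) (at t within {0..T})"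
    and ge: "\<And>t. t \<in> {0..T} \<Longrightarrow> \<phi>' t \<ge> - k * \<phi> t"
  shows "\<phi> T \<ge> 0"
proof -
  have "\<exists>t\<in>{0..T}. \<phi> T * exp (k * T) - \<phi> 0 * exp (k * 0) = (T - 0) * ((\<phi>' t + k * \<phi> t) * exp (k * t))"
  proof (rule mvt_very_simple[OF assms(1), of "\<lambda>t. \<phi> t * exp (k * t)" "\<lambda>t h. h * ((\<phi>' t + k * \<phi> t) * exp (k * t))"])
    fix t assume t: "0 \<le> t" "t \<le> T"
    have "((\<lambda>t. \<phi> t * exp (k * t)) has_real_derivative (\<phi>' t + k * \<phi> t) * exp (k * t)) (at t within {0..T})"
      using d[of t] t by (auto intro!: derivative_eq_intros simp: algebra_simps)
    then show "((\<lambda>t. \<phi> t * exp (k * t)) has_derivative (\<lambda>h. h * ((\<phi>' t + k * \<phi> t) * exp (k * t)))) (at t within {0..T})"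
      by (simp add: has_field_derivative_def mult_commute_abs)
  qed
  then obtain t where t: "t \<in> {0..T}" "\<phi> T * exp (k * T) - \<phi> 0 = T * ((\<phi>' t + k * \<phi> t) * exp (k * t))"
    by auto
  have "T * ((\<phi>' t + k * \<phi> t) * exp (k * t)) \<ge> 0" using ge[OF t(1)] assms(1) by simp
  then have "\<phi> T * exp (k * T) \<ge> 0" using t(2) assms(2) by linarith
  then show ?thesis by (simp add: zero_le_mult_iff)
qed

text \<open>A Lyapunov function that is comparable to the squared distance and decays at a rate proportional to
  itself gives the estimate \<open>dist (z t) p \<le> sqrt (c2 / c1) exp (- \<delta> t / 2) dist (z 0) p\<close>, which contains both
  stability and attractivity.\<close>

lemma globally_asymp_stable_relI:
  fixes F :: "'a::euclidean_space \<Rightarrow> 'a"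
  assumes I: "compact I" and U: "open U" "I \<subseteq> U" "U \<subseteq> D" "continuous_on U F"
    and inv: "forward_invariant F D I"
    and c: "c1 > 0" "c2 > 0" "\<delta> > 0"
    and V: "\<And>z. z \<in> I \<Longrightarrow> (V has_derivative V' z) (at z)"
    and V1: "\<And>z. z \<in> I \<Longrightarrow> c1 * (dist z p)\<^sup>2 \<le> V z" and V2: "\<And>z. z \<in> I \<Longrightarrow> V z \<le> c2 * (dist z p)\<^sup>2"
    and V3: "\<And>z. z \<in> I \<Longrightarrow> V' z (F z) \<le> - \<delta> * V z"
  shows "globally_asymp_stable_rel F D I p"
proof -
  have inI: "z t \<in> I" if "solution F D {0..} z" "z 0 \<in> I" "t \<ge> 0" for z t
    using that(2,3) by (rule_tac forward_invariantD[OF inv _ solution_subset[OF that(1)]]) auto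
  have decay: "V (z T) \<le> V (z 0) * exp (- \<delta> * T)" if z: "solution F D {0..} z" "z 0 \<in> I" and T: "T \<ge> 0" for z T
  proof -
    have "V (z 0) * exp (- \<delta> * T) - V (z T) \<ge> 0"
    proof (rule nonneg_by_comparison[OF T, of "\<lambda>t. V (z 0) * exp (- \<delta> * t) - V (z t)"])
      fix t assume t: "t \<in> {0..T}"
      have zt: "z t \<in> I" using t z by (rule_tac inI[OF z]) auto
      have "((\<lambda>s. V (z s)) has_real_derivative V' (z t) (F (z t))) (at t within {0..T})"
        using t by (intro solution_chain[OF solution_subset[OF z(1)] _ V[OF zt]]) auto
      then show "((\<lambda>t. V (z 0) * exp (- \<delta> * t) - V (z t)) has_real_derivative
          - \<delta> * V (z 0) * exp (- \<delta> * t) - V' (z t) (F (z t))) (at t within {0..T})"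
        by (auto intro!: derivative_eq_intros)
      show "- \<delta> * V (z 0) * exp (- \<delta> * t) - V' (z t) (F (z t)) \<ge> - \<delta> * (V (z 0) * exp (- \<delta> * t) - V (z t))"
        using V3[OF zt] by (simp add: algebra_simps)
    qed simp
    then show ?thesis by simp
  qed
  define C where "C = c2 / c1"
  have C: "C > 0" using c by (simp add: C_def)
  have est: "(dist (z t) p)\<^sup>2 \<le> C * (dist (z 0) p)\<^sup>2 * exp (- \<delta> * t)"
    if z: "solution F D {0..} z" "z 0 \<in> I" and t: "t \<ge> 0" for z t
  proof -
    have "c1 * (dist (z t) p)\<^sup>2 \<le> V (z 0) * exp (- \<delta> * t)"
      using V1[OF inI[OF z t]] decay[OF z t] by linarith
    also have "\<dots> \<le> c2 * (dist (z 0) p)\<^sup>2 * exp (- \<delta> * t)"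
      using V2[OF z(2)] by (intro mult_right_mono) auto
    finally show ?thesis using c by (simp add: C_def field_simps)
  qed
  show ?thesis unfolding globally_asymp_stable_rel_def
  proof (intro conjI ballI allI impI)
    fix z0 assume "z0 \<in> I"
    then show "\<exists>z. solution F D {0..} z \<and> z 0 = z0" using global_solutions[OF I U inv] by blast
  next
    fix T y assume "T > 0" "solution F D {0..<T} y \<and> y 0 \<in> I"
    then show "\<exists>z. solution F D {0..} z \<and> (\<forall>t\<in>{0..<T}. z t = y t)"
      using continuation[OF I U inv] by blast
  next
    fix z t assume "solution F D {0..} z \<and> z 0 \<in> I" "(0::real) \<le> t"
    then show "z t \<in> I" using inI by blast
  next
    fix e :: real assume e: "e > 0"
    show "\<exists>d>0. \<forall>z. solution F D {0..} z \<and> z 0 \<in> I \<and> dist (z 0) p < d \<longrightarrow> (\<forall>t\<ge>0. dist (z t) p < e)"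
    proof (intro exI[of _ "e / sqrt C"] conjI allI impI)
      fix z t assume z: "solution F D {0..} z \<and> z 0 \<in> I \<and> dist (z 0) p < e / sqrt C" and t: "(0::real) \<le> t"
      have "(dist (z t) p)\<^sup>2 \<le> C * (dist (z 0) p)\<^sup>2 * exp (- \<delta> * t)" using est z t by blast
      also have "\<dots> \<le> C * (dist (z 0) p)\<^sup>2 * 1" using C c t by (intro mult_left_mono) auto
      also have "\<dots> < C * (e / sqrt C)\<^sup>2"
        using C z by (auto intro!: mult_strict_left_mono power_strict_mono)
      also have "\<dots> = e\<^sup>2" using C by (simp add: power_divide)
      finally show "dist (z t) p < e" using e by (rule_tac power2_less_imp_less) auto
    qed (use e C in auto)
  next
    fix z assume z: "solution F D {0..} z \<and> z 0 \<in> I"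
    have "((\<lambda>t. exp (- \<delta> * t)) \<longlongrightarrow> 0) at_top"
      using c by (intro filterlim_compose[OF exp_at_bot] filterlim_tendsto_neg_mult_at_bot[OF tendsto_const] filterlim_ident) auto
    then have "((\<lambda>t. C * (dist (z 0) p)\<^sup>2 * exp (- \<delta> * t)) \<longlongrightarrow> 0) at_top"
      by (rule tendsto_mult_right_zero)
    then have "((\<lambda>t. (dist (z t) p)\<^sup>2) \<longlongrightarrow> 0) at_top"
      by (rule Lim_null_comparison[rotated])
         (use est z in \<open>auto intro!: eventually_mono[OF eventually_ge_at_top[of 0]]\<close>)
    then have "((\<lambda>t. sqrt ((dist (z t) p)\<^sup>2)) \<longlongrightarrow> sqrt 0) at_top" by (rule tendsto_real_sqrt)
    then show "(z \<longlongrightarrow> p) at_top" by (simp add: tendsto_dist_iff[symmetric])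
  qed
qed

section \<open>The safe gradient flow\<close>

lemma concave_below_tangent:
  fixes g :: "'a::real_normed_vector \<Rightarrow> real"
  assumes cv: "convex_on UNIV (\<lambda>u. - g u)" and d: "(g has_derivative g') (at u)"
  shows "g v \<le> g u + g' (v - u)"
proof -
  have "((\<lambda>t. u + t *\<^sub>R (v - u)) has_derivative (\<lambda>t. t *\<^sub>R (v - u))) (at 0 within {0<..})"
    by (auto intro!: derivative_eq_intros)
  from has_derivative_compose[OF this, of g g'] d
  have "((\<lambda>t. g (u + t *\<^sub>R (v - u))) has_derivative (\<lambda>t. g' (t *\<^sub>R (v - u)))) (at 0 within {0<..})"
    by simp
  moreover have "g' (t *\<^sub>R (v - u)) = t * g' (v - u)" for t
    using linear_cmul[OF has_derivative_linear[OF d], of t "v - u"] by simp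
  ultimately have "((\<lambda>t. g (u + t *\<^sub>R (v - u))) has_real_derivative g' (v - u)) (at 0 within {0<..})"
    by (simp add: has_field_derivative_def mult_commute_abs)
  then have lim: "((\<lambda>t. (g (u + t *\<^sub>R (v - u)) - g u) / t) \<longlongrightarrow> g' (v - u)) (at_right 0)"
    by (simp add: has_field_derivative_iff)
  have "g v - g u \<le> g' (v - u)"
  proof (rule tendsto_lowerbound[OF lim])
    have "\<forall>\<^sub>F t in at_right 0. t < (1::real)" by (rule eventually_at_right_real[OF zero_less_one, THEN eventually_mono]) auto
    then show "\<forall>\<^sub>F t in at_right 0. g v - g u \<le> (g (u + t *\<^sub>R (v - u)) - g u) / t"
      using eventually_at_right_less[of 0]
    proof eventually_elim
      case (elim t)
      have "- g ((1 - t) *\<^sub>R u + t *\<^sub>R v) \<le> (1 - t) * - g u + t * - g v"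
        using elim by (intro convex_onD[OF cv]) auto
      moreover have "(1 - t) *\<^sub>R u + t *\<^sub>R v = u + t *\<^sub>R (v - u)" by (simp add: algebra_simps)
      ultimately show ?case using elim by (simp add: field_simps)
    qed
  qed simp
  then show ?thesis by simp
qed

lemma sgf_feasible_halfspace_pair:
  "sgf_feasible \<alpha> \<gamma> f hr b (x, u) =
     halfspace_pair (grad b u) (\<alpha> * b u) (grad_u hr (x, u)) (grad_x hr (x, u) \<bullet> f (x, u) + \<gamma> * hr (x, u))"
  by (auto simp: sgf_feasible_def halfspace_pair_def algebra_simps)

lemma arg_min_on_eq_closest_point:
  fixes v :: "'b::euclidean_space"
  shows "arg_min_on (\<lambda>q. 1 / 2 * (norm (q + v))\<^sup>2) S = closest_point S (- v)"
proof -
  have "1 / 2 * (norm (y + v))\<^sup>2 < 1 / 2 * (norm (q + v))\<^sup>2 \<longleftrightarrow> \<not> dist (- v) q \<le> dist (- v) y" for q y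
    by (simp add: dist_norm norm_minus_commute[of "- v"] power_mono_iff linorder_not_le[symmetric])
  then have "is_arg_min (\<lambda>q. 1 / 2 * (norm (q + v))\<^sup>2) (\<lambda>q. q \<in> S) =
      (\<lambda>q. q \<in> S \<and> (\<forall>y\<in>S. dist (- v) q \<le> dist (- v) y))"
    unfolding is_arg_min_def by blast
  then show ?thesis by (simp add: arg_min_on_def arg_min_def closest_point_def)
qed

lemma sgf_closest_point:
  "sgf \<epsilon> \<alpha> \<gamma> f w \<Phi> hr b (x, u) =
     closest_point (sgf_feasible \<alpha> \<gamma> f hr b (x, u)) (- (\<epsilon> *\<^sub>R (transpose (jacobian w (at u)) *v grad \<Phi> x)))"
  unfolding sgf_def case_prod_conv by (rule arg_min_on_eq_closest_point)

lemma sgf_in_feasible: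
  assumes "sgf_feasible \<alpha> \<gamma> f hr b (x, u) \<noteq> {}"
  shows "sgf \<epsilon> \<alpha> \<gamma> f w \<Phi> hr b (x, u) \<in> sgf_feasible \<alpha> \<gamma> f hr b (x, u)"
  using assms unfolding sgf_closest_point by (auto intro!: closest_point_in_set simp: sgf_feasible_halfspace_pair closed_halfspace_pair)

text \<open>The two constraints of the quadratic program are differential inequalities that keep \<open>b\<close> and the last barrier
  function nonnegative along any solution, whatever the objective. Once this is known, the
  trajectory stays in the set where the lower barrier functions have zero input gradient, so
  that \<open>h\<^sub>i' = h\<^sub>i\<^sub>+\<^sub>1 - \<beta> h\<^sub>i\<close> and nonnegativity descends from \<open>i + 1\<close> to \<open>i\<close>.\<close>

lemma safe_forward_invariant:
  fixes f :: "(real ^ 'n) \<times> (real ^ 'm) \<Rightarrow> real ^ 'n" and b :: "real ^ 'm \<Rightarrow> real"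
  assumes f: "cont_diff (r + 1) f" and h: "cont_diff (r + 2) h" and b: "cont_diff 1 b"
    and rel: "\<And>z i. z \<in> safe_set \<beta> f h b r \<Longrightarrow> i < r \<Longrightarrow> grad_u (hcbf \<beta> f h i) z = 0"
  shows "forward_invariant (sgf_closed_loop \<epsilon> \<alpha> \<gamma> f w \<Phi> (hcbf \<beta> f h r) b)
     {z. sgf_feasible \<alpha> \<gamma> f (hcbf \<beta> f h r) b z \<noteq> {}} (\<Inter>i\<in>{0..r}. safe_set \<beta> f h b i)"
  unfolding forward_invariant_def
proof (intro allI impI)
  let ?h = "hcbf \<beta> f h"
  let ?F = "sgf_closed_loop \<epsilon> \<alpha> \<gamma> f w \<Phi> (?h r) b"
  let ?D = "{z. sgf_feasible \<alpha> \<gamma> f (?h r) b z \<noteq> {}}"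
  fix T :: real and z
  assume T: "0 \<le> T" and z: "solution ?F ?D {0..T} z \<and> z 0 \<in> (\<Inter>i\<in>{0..r}. safe_set \<beta> f h b i)"
  let ?q = "\<lambda>t. sgf \<epsilon> \<alpha> \<gamma> f w \<Phi> (?h r) b (z t)"
  have hd: "(?h i has_derivative frechet_derivative (?h i) (at y)) (at y)" if "i \<le> r" for i y
    using cont_diff_hcbf[OF f h, of i "Suc (r + 1 - i)"] that by (intro cont_diff_has_derivative) auto
  have b0: "b (snd (z 0)) \<ge> 0" and h0: "\<And>i. i \<le> r \<Longrightarrow> ?h i (z 0) \<ge> 0"
    using z by (auto simp: safe_set_def)
  have Fz: "?F (z t) = (f (z t), ?q t)" for t by (simp add: sgf_closed_loop_def)
  have feas: "grad b (snd (z t)) \<bullet> ?q t + \<alpha> * b (snd (z t)) \<ge> 0"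
      "grad_x (?h r) (z t) \<bullet> f (z t) + grad_u (?h r) (z t) \<bullet> ?q t + \<gamma> * ?h r (z t) \<ge> 0" if "t \<in> {0..T}" for t
  proof -
    obtain x u where xu: "z t = (x, u)" by (cases "z t")
    have "z t \<in> ?D" using z that unfolding solution_def by blast
    then have "sgf_feasible \<alpha> \<gamma> f (?h r) b (x, u) \<noteq> {}" by (simp add: xu)
    from sgf_in_feasible[OF this, of \<epsilon> w \<Phi>]
    show "grad b (snd (z t)) \<bullet> ?q t + \<alpha> * b (snd (z t)) \<ge> 0"
      "grad_x (?h r) (z t) \<bullet> f (z t) + grad_u (?h r) (z t) \<bullet> ?q t + \<gamma> * ?h r (z t) \<ge> 0"
      by (auto simp: sgf_feasible_def xu)
  qed
  have chain: "((\<lambda>s. g (z s)) has_real_derivative g' (f (z t), ?q t)) (at t within {0..s})"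
    if "t \<in> {0..s}" "s \<le> T" "(g has_derivative g') (at (z t))" for g g' t s
    using solution_chain[OF solution_subset[OF conjunct1[OF z], of "{0..s}"], of t g g'] that by (simp add: Fz)
  have bd: "((\<lambda>z. b (snd z)) has_derivative (\<lambda>v. frechet_derivative b (at (snd y)) (snd v))) (at y)" for y :: "(real^'n) \<times> (real^'m)"
    using b by (auto intro!: has_derivative_compose[OF _ cont_diff_has_derivative[of 0 b]] derivative_eq_intros)
  have bb: "grad b u \<bullet> v = frechet_derivative b (at u) v" for u v
    using b by (intro grad_inner cont_diff_has_derivative[of 0]) auto
  have bpos: "b (snd (z s)) \<ge> 0" if "s \<in> {0..T}" for s
  proof (rule nonneg_by_comparison[of s "\<lambda>t. b (snd (z t))" "\<lambda>t. grad b (snd (z t)) \<bullet> ?q t" \<alpha>])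
    fix t assume t: "t \<in> {0..s}"
    show "((\<lambda>t. b (snd (z t))) has_real_derivative grad b (snd (z t)) \<bullet> ?q t) (at t within {0..s})"
      using chain[OF t _ bd] that by (simp add: bb)
    show "grad b (snd (z t)) \<bullet> ?q t \<ge> - \<alpha> * b (snd (z t))" using feas(1)[of t] t that by auto
  qed (use that b0 in auto)
  have dh: "((\<lambda>t. ?h i (z t)) has_real_derivative grad_x (?h i) (z t) \<bullet> f (z t) + grad_u (?h i) (z t) \<bullet> ?q t) (at t within {0..s})"
    if "t \<in> {0..s}" "s \<le> T" "i \<le> r" for i t s
    using chain[OF that(1,2) hd[OF that(3)]] by (simp add: derivative_split[OF hd[OF that(3)]])
  have hrpos: "?h r (z s) \<ge> 0" if "s \<in> {0..T}" for s
  proof (rule nonneg_by_comparison[of s "\<lambda>t. ?h r (z t)" _ \<gamma>])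
    fix t assume t: "t \<in> {0..s}"
    show "((\<lambda>t. ?h r (z t)) has_real_derivative grad_x (?h r) (z t) \<bullet> f (z t) + grad_u (?h r) (z t) \<bullet> ?q t) (at t within {0..s})"
      using that by (intro dh t) auto
    show "grad_x (?h r) (z t) \<bullet> f (z t) + grad_u (?h r) (z t) \<bullet> ?q t \<ge> - \<gamma> * ?h r (z t)"
      using feas(2)[of t] t that by auto
  qed (use that h0 in auto)
  have safe: "z t \<in> safe_set \<beta> f h b r" if "t \<in> {0..T}" for t
    using bpos[OF that] hrpos[OF that] by (auto simp: safe_set_def split: prod.split)
  have all: "\<forall>s\<in>{0..T}. ?h i (z s) \<ge> 0" if "i \<le> r" for i
    using that
  proof (induction rule: inc_induct)
    case base
    then show ?case using hrpos by blast
  next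
    case (step i)
    show ?case
    proof
      fix s assume s: "s \<in> {0..T}"
      show "?h i (z s) \<ge> 0"
      proof (rule nonneg_by_comparison[of s "\<lambda>t. ?h i (z t)" _ \<beta>])
        fix t assume t: "t \<in> {0..s}"
        show "((\<lambda>t. ?h i (z t)) has_real_derivative grad_x (?h i) (z t) \<bullet> f (z t) + grad_u (?h i) (z t) \<bullet> ?q t) (at t within {0..s})"
          using s step by (intro dh t) auto
        have "?h (Suc i) (z t) \<ge> 0" "grad_u (?h i) (z t) = 0"
          using step s t safe[of t] rel[of "z t" i] by auto
        then show "grad_x (?h i) (z t) \<bullet> f (z t) + grad_u (?h i) (z t) \<bullet> ?q t \<ge> - \<beta> * ?h i (z t)"
          by simp
      qed (use s h0[of i] step in auto)
    qed
  qed
  show "z T \<in> (\<Inter>i\<in>{0..r}. safe_set \<beta> f h b i)"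
    using bpos[of T] bspec[OF all, of _ T] T by (cases "z T") (auto simp: safe_set_def)
qed

text \<open>If \<open>P\<close> contains a ball of radius \<open>\<rho>\<close> around \<open>g + d\<close>, where \<open>g\<close> is the projection of \<open>T\<close>, then the correction
  \<open>g - T\<close> has a component along \<open>d\<close> proportional to its length: test the variational inequality with the
  point of the ball that lies farthest in the direction \<open>T - g\<close>.\<close>

lemma closest_point_push:
  fixes P :: "'b::euclidean_space set"
  assumes P: "closed P" "convex P" and \<rho>: "\<rho> \<ge> 0"
    and feas: "\<And>v. norm v \<le> 1 \<Longrightarrow> closest_point P T + d + \<rho> *\<^sub>R v \<in> P"
  shows "\<rho> * norm (closest_point P T - T) \<le> (closest_point P T - T) \<bullet> d"
proof -
  let ?g = "closest_point P T"
  let ?v = "- sgn (?g - T)"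
  have "?g + d + \<rho> *\<^sub>R ?v \<in> P" by (intro feas) (simp add: norm_sgn)
  from closest_point_dot[OF P(2,1) this, of T]
  have "(T - ?g) \<bullet> (d + \<rho> *\<^sub>R ?v) \<le> 0" by (simp add: algebra_simps)
  moreover have "(?g - T) \<bullet> sgn (?g - T) = norm (?g - T)"
    by (cases "?g = T") (simp_all add: sgn_div_norm dot_square_norm power2_eq_square)
  moreover have "(T - ?g) \<bullet> (d + \<rho> *\<^sub>R ?v) = \<rho> * ((?g - T) \<bullet> sgn (?g - T)) - (?g - T) \<bullet> d"
    by (simp add: inner_diff_left inner_add_right algebra_simps)
  ultimately show ?thesis by simp
qed

text \<open>Here \<open>s\<close> is the current value of a constraint function, \<open>a\<close> its input gradient and \<open>c\<close> its drift. If
  \<open>s \<le> \<eta> / 2\<close>, the step \<open>d\<close> gains at least \<open>\<eta> / 2\<close>, which pays for the perturbation \<open>v\<close>; otherwise the term \<open>\<alpha> s\<close>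
  dominates everything that is bounded.\<close>

lemma slack_keeps_feasible:
  fixes a d g v :: "'b::real_inner"
  assumes ad: "a \<bullet> d \<ge> \<eta> - s" and s: "s \<ge> 0" and \<eta>: "\<eta> > 0" and M: "M > 0" "norm a \<le> M" "\<bar>c\<bar> \<le> M"
    and g: "a \<bullet> g + c + \<alpha> * s \<ge> 0" and v: "norm v \<le> 1"
    and Q: "norm (g + d + (\<eta> / (2 * M)) *\<^sub>R v) \<le> Q"
    and \<alpha>: "\<alpha> \<ge> 2 * M * (Q + 1) / \<eta>"
  shows "a \<bullet> (g + d + (\<eta> / (2 * M)) *\<^sub>R v) + c + \<alpha> * s \<ge> 0"
proof (cases "s \<le> \<eta> / 2")
  case True
  have "\<bar>a \<bullet> v\<bar> \<le> norm a * norm v" by (rule Cauchy_Schwarz_ineq2)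
  also have "\<dots> \<le> M * 1" using M v by (intro mult_mono) auto
  finally have "\<eta> / (2 * M) * (a \<bullet> v) \<ge> \<eta> / (2 * M) * (- M)" using \<eta> M by (intro mult_left_mono) auto
  then have "\<eta> / (2 * M) * (a \<bullet> v) \<ge> - \<eta> / 2" using M by simp
  then show ?thesis using True ad g by (simp add: inner_add_right)
next
  case False
  let ?q = "g + d + (\<eta> / (2 * M)) *\<^sub>R v"
  have Q0: "Q \<ge> 0" using Q norm_ge_zero order_trans by blast
  have "\<bar>a \<bullet> ?q\<bar> \<le> norm a * norm ?q" by (rule Cauchy_Schwarz_ineq2)
  also have "\<dots> \<le> M * Q" using M Q by (intro mult_mono) auto
  finally have "a \<bullet> ?q \<ge> - (M * Q)" by linarith
  moreover have "\<alpha> * s \<ge> 2 * M * (Q + 1) / \<eta> * (\<eta> / 2)"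
    using \<alpha> False \<eta> M Q0 by (intro mult_mono) (auto intro: order_trans[OF _ \<alpha>])
  then have "\<alpha> * s \<ge> M * (Q + 1)" using \<eta> by simp
  ultimately show ?thesis using M(3) by (simp add: distrib_left)
qed

lemma strictly_feasible_direction:
  fixes a d :: "'b::real_inner"
  assumes ad: "a \<bullet> d \<ge> \<eta> - s" and s: "s \<ge> 0" and \<eta>: "\<eta> > 0" and M: "M > 0" "\<bar>c\<bar> \<le> M" and \<alpha>: "\<alpha> \<ge> 2 * M / \<eta>"
  shows "a \<bullet> ((2 * M / \<eta>) *\<^sub>R d) + c + \<alpha> * s > 0"
proof -
  have "2 * M / \<eta> * (a \<bullet> d) \<ge> 2 * M / \<eta> * (\<eta> - s)" using ad \<eta> M by (intro mult_left_mono) auto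
  moreover have "2 * M / \<eta> * (\<eta> - s) = 2 * M - 2 * M / \<eta> * s" using \<eta> by (simp add: field_simps)
  moreover have "2 * M / \<eta> * s \<le> \<alpha> * s" using \<alpha> s by (intro mult_right_mono)
  ultimately show ?thesis using M by simp
qed

text \<open>The choice of \<open>K\<close> removes \<open>n\<close>, the size of the correction made by the projection; the mixed term in \<open>e\<close> and \<open>y\<close> is then
  split by Young's inequality so that half of the decay in \<open>y\<close> survives.\<close>

lemma lyapunov_arith:
  fixes e y n p :: real
  assumes "K > 0" "c > 0" "\<epsilon> > 0" "n \<ge> 0" "e \<ge> 0" "d4 \<ge> 0"
    and Kk: "d4 * e \<le> K * \<kappa>" and p: "p \<le> P * (e + y)"
  shows "- d3 * e\<^sup>2 + d4 * e * (n + \<epsilon> * p) + K * (- \<epsilon> * c * y\<^sup>2 + \<epsilon> * L * e * y - \<kappa> * n)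
     \<le> - (d3 - \<epsilon> * (d4 * P + (d4 * P + K * L)\<^sup>2 / (2 * K * c))) * e\<^sup>2 - \<epsilon> * K * c / 2 * y\<^sup>2"
proof -
  let ?A = "d4 * P + K * L"
  have "d4 * e * n \<le> K * \<kappa> * n" using Kk assms by (intro mult_right_mono)
  moreover have "d4 * e * (\<epsilon> * p) \<le> d4 * e * (\<epsilon> * (P * (e + y)))"
    using p assms by (intro mult_left_mono) auto
  moreover have "?A * e * y \<le> ?A\<^sup>2 / (2 * K * c) * e\<^sup>2 + K * c / 2 * y\<^sup>2"
  proof -
    have "0 \<le> (?A * e - K * c * y)\<^sup>2 / (2 * K * c)" using assms by simp
    also have "\<dots> = ?A\<^sup>2 / (2 * K * c) * e\<^sup>2 + K * c / 2 * y\<^sup>2 - ?A * e * y"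
      using assms by (simp add: power2_eq_square field_simps)
    finally show ?thesis by simp
  qed
  then have "\<epsilon> * (?A * e * y) \<le> \<epsilon> * (?A\<^sup>2 / (2 * K * c) * e\<^sup>2 + K * c / 2 * y\<^sup>2)"
    using assms by (intro mult_left_mono) auto
  ultimately show ?thesis by (simp add: algebra_simps power2_eq_square) 
qed

lemma grad_eqI:
  fixes g :: "'a::euclidean_space \<Rightarrow> real"
  assumes "(g has_derivative (\<lambda>v. D \<bullet> v)) (at x)"
  shows "grad g x = D"
  using grad_inner[OF assms] by (metis vector_eq_rdot)

section \<open>The steady-state gradient\<close>

lemma grad_eq_0_at_minimum:
  fixes g :: "'a::euclidean_space \<Rightarrow> real"
  assumes "open S" "x \<in> S" "\<And>y. y \<in> S \<Longrightarrow> g x \<le> g y" "g differentiable (at x)"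
  shows "grad g x = 0"
proof -
  have d: "(g has_derivative frechet_derivative g (at x)) (at x)"
    using assms(4) by (simp add: frechet_derivative_works)
  then have "frechet_derivative g (at x) = (\<lambda>v. 0)"
    using assms by (intro differential_zero_maxmin[of x S g]) auto
  then show ?thesis using d by (intro grad_eqI) simp
qed

lemma strongly_convex_monotone:
  assumes "strongly_convex c \<psi>"
  shows "(grad \<psi> x - grad \<psi> y) \<bullet> (x - y) \<ge> c * (norm (x - y))\<^sup>2"
proof -
  have "\<psi> x \<ge> \<psi> y + grad \<psi> y \<bullet> (x - y) + c / 2 * (norm (x - y))\<^sup>2"
    "\<psi> y \<ge> \<psi> x + grad \<psi> x \<bullet> (y - x) + c / 2 * (norm (y - x))\<^sup>2"
    using assms by (auto simp: strongly_convex_def)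
  moreover have "grad \<psi> x \<bullet> (y - x) = - (grad \<psi> x \<bullet> (x - y))" by (simp add: inner_diff_right)
  ultimately show ?thesis by (simp add: inner_diff_left norm_minus_commute[of y x])
qed

text \<open>On the steady-state manifold \<open>x = w u\<close> this is the gradient of \<open>\<Phi> \<circ> w\<close>; the controller evaluates it at
  the measured state \<open>x\<close> instead.\<close>

definition pullback_grad :: "(real ^ 'm \<Rightarrow> real ^ 'n) \<Rightarrow> (real ^ 'n \<Rightarrow> real) \<Rightarrow> (real ^ 'n) \<times> (real ^ 'm) \<Rightarrow> real ^ 'm" where
  "pullback_grad w \<Phi> z = transpose (jacobian w (at (snd z))) *v grad \<Phi> (fst z)"

lemma pullback_grad_inner:
  fixes w :: "real ^ 'm \<Rightarrow> real ^ 'n"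
  assumes "w differentiable (at (snd z))"
  shows "pullback_grad w \<Phi> z \<bullet> v = grad \<Phi> (fst z) \<bullet> frechet_derivative w (at (snd z)) v"
proof -
  have "frechet_derivative w (at (snd z)) = (\<lambda>h. jacobian w (at (snd z)) *v h)"
    using assms jacobian_works by (intro frechet_derivative_eqI) blast
  then show ?thesis by (simp add: pullback_grad_def dot_lmul_matrix)
qed

lemma cont_diff_pullback_grad:
  fixes w :: "real ^ 'm \<Rightarrow> real ^ 'n"
  assumes w: "cont_diff 2 w" and \<Phi>: "cont_diff 2 \<Phi>"
  shows "cont_diff 1 (pullback_grad w \<Phi>)"
proof -
  have w': "cont_diff (Suc 1) w" and \<Phi>': "cont_diff (Suc 1) \<Phi>" using w \<Phi> by (auto simp: numeral_2_eq_2)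
  have "pullback_grad w \<Phi> z = (\<Sum>i\<in>Basis. (grad \<Phi> (fst z) \<bullet> frechet_derivative w (at (snd z)) i) *\<^sub>R i)" for z
    by (subst euclidean_representation[symmetric])
       (simp only: pullback_grad_inner[OF cont_diff_differentiable[OF w']])
  then have eq: "pullback_grad w \<Phi> = (\<lambda>z. \<Sum>i\<in>Basis. (grad \<Phi> (fst z) \<bullet> frechet_derivative w (at (snd z)) i) *\<^sub>R i)"
    by blast
  have "cont_diff 1 (grad \<Phi>)" using \<Phi>' by (rule cont_diff_grad)
  moreover have "cont_diff 1 (\<lambda>u. frechet_derivative w (at u) i)" for i using w' by (simp only: cont_diff.simps)
  ultimately show ?thesis unfolding eq
    by (intro cont_diff_sum cont_diff_scaleR cont_diff_inner cont_diff_const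
        cont_diff_compose_linear[OF bounded_linear_fst, where g = "grad \<Phi>"]
        cont_diff_compose_linear[OF bounded_linear_snd, where g = "\<lambda>u. frechet_derivative w (at u) _"])
qed

lemma grad_compose:
  fixes w :: "real ^ 'm \<Rightarrow> real ^ 'n"
  assumes "w differentiable (at u)" "\<Phi> differentiable (at (w u))"
  shows "grad (\<lambda>u. \<Phi> (w u)) u = pullback_grad w \<Phi> (w u, u)"
proof (rule grad_eqI)
  have d\<Phi>: "(\<Phi> has_derivative frechet_derivative \<Phi> (at (w u))) (at (w u))"
    using assms by (simp add: frechet_derivative_works)
  have "((\<lambda>u. \<Phi> (w u)) has_derivative (\<lambda>v. frechet_derivative \<Phi> (at (w u)) (frechet_derivative w (at u) v))) (at u)"
    using assms(1) by (intro has_derivative_compose[where f = w, OF _ d\<Phi>]) (simp add: frechet_derivative_works[symmetric])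
  moreover have "frechet_derivative \<Phi> (at (w u)) (frechet_derivative w (at u) v) = pullback_grad w \<Phi> (w u, u) \<bullet> v" for v
    using pullback_grad_inner[of w "(w u, u)" \<Phi> v] assms(1) by (simp add: grad_inner[OF d\<Phi>])
  ultimately show "((\<lambda>u. \<Phi> (w u)) has_derivative (\<lambda>v. pullback_grad w \<Phi> (w u, u) \<bullet> v)) (at u)" by simp
qed

lemma hcbf_at_equilibrium:
  "f (x, u) = 0 \<Longrightarrow> hcbf \<beta> f h i (x, u) = \<beta> ^ i * h x"
  by (induction i) auto

lemma compact_bounded_image:
  assumes "compact I" "continuous_on UNIV g"
  obtains B where "B \<ge> 0" "\<And>z. z \<in> I \<Longrightarrow> norm (g z) \<le> B"
proof -
  have "bounded (g ` I)"
    using assms by (intro compact_imp_bounded compact_continuous_image) (auto intro: continuous_on_subset)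
  then show thesis using that unfolding bounded_pos by (metis imageI less_imp_le)
qed

section \<open>Asymptotic stability of the optimum\<close>

theorem theoremV7:
  fixes f :: "(real ^ 'n) \<times> (real ^ 'm) \<Rightarrow> real ^ 'n"
    and w :: "real ^ 'm \<Rightarrow> real ^ 'n"
    and \<Phi> h :: "real ^ 'n \<Rightarrow> real"
    and b :: "real ^ 'm \<Rightarrow> real"
    and W :: "(real ^ 'n) \<times> (real ^ 'm) \<Rightarrow> real"
    and hr :: "(real ^ 'n) \<times> (real ^ 'm) \<Rightarrow> real"
    and I :: "((real ^ 'n) \<times> (real ^ 'm)) set"
    and \<beta> c \<sigma> l\<^sub>f d\<^sub>1 d\<^sub>2 d\<^sub>3 d\<^sub>4 :: real
    and r :: nat
    and xs :: "real ^ 'n" and us :: "real ^ 'm"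
  assumes "\<beta> > 0"
    and hr_def: "hr = hcbf \<beta> f h r"
    and I_def: "I = (\<Inter>i\<in>{0..r}. safe_set \<beta> f h b i)"
    and "plant_assumption f w"
    and "constraint_assumption r \<beta> f w \<Phi> h b"
    and "converse_lyapunov f w W d\<^sub>1 d\<^sub>2 d\<^sub>3 d\<^sub>4"
    and "sigma_constant \<sigma> f hr b I"
    and "compact I"
    and "\<forall>(x, u)\<in>I. \<exists>q.
           (b u = 0 \<longrightarrow> grad b u \<bullet> q > 0) \<and>
           (hr (x, u) = 0 \<longrightarrow> grad_u hr (x, u) \<bullet> q + grad_x hr (x, u) \<bullet> f (x, u) > 0)"
    and "\<forall>(x, u)\<in>I. b u = 0 \<and> hr (x, u) = 0 \<longrightarrow>
           grad b u \<noteq> grad_u hr (x, u) \<and> independent {grad b u, grad_u hr (x, u)}"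
    and "c > 0" and "strongly_convex c (\<lambda>u. \<Phi> (w u))"
    and "convex_on UNIV (\<lambda>u. - b u)"
    and "\<forall>x. convex_on UNIV (\<lambda>u. - hr (x, u))"
    and "steady_state_optimizer w \<Phi> h b (xs, us)"
    and "\<forall>z. steady_state_optimizer w \<Phi> h b z \<longrightarrow> z = (xs, us)"
    and "b us > 0"
    and "\<forall>x. (\<exists>u. (x, u) \<in> I) \<longrightarrow> hr (x, us) > 0"
    and "l\<^sub>f-lipschitz_on I f"
    and "d\<^sub>3 - d\<^sub>4 * (1 + 1 / \<sigma>) * l\<^sub>f > 0"
  shows "\<exists>\<alpha>0>0. \<exists>\<gamma>0>0. \<exists>\<epsilon>0>0. \<forall>\<alpha>>\<alpha>0. \<forall>\<gamma>>\<gamma>0. \<forall>\<epsilon>. 0 < \<epsilon> \<and> \<epsilon> < \<epsilon>0 \<longrightarrow>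
           globally_asymp_stable_rel
             (sgf_closed_loop \<epsilon> \<alpha> \<gamma> f w \<Phi> hr b)
             {z. sgf_feasible \<alpha> \<gamma> f hr b z \<noteq> {}}
             I (xs, us)"
proof -
  note ca = \<open>constraint_assumption r \<beta> f w \<Phi> h b\<close>[unfolded constraint_assumption_def]
  note cl = \<open>converse_lyapunov f w W d\<^sub>1 d\<^sub>2 d\<^sub>3 d\<^sub>4\<close>[unfolded converse_lyapunov_def]
  note so = \<open>steady_state_optimizer w \<Phi> h b (xs, us)\<close>[unfolded steady_state_optimizer_def is_arg_min_def]
  note I = \<open>compact I\<close>
  have f: "cont_diff (r + 1) f" and h: "cont_diff (r + 2) h" and b2: "cont_diff 2 b"
    and \<Phi>: "cont_diff 2 \<Phi>" and w: "cont_diff 2 w"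
    and rel: "\<And>z i. z \<in> safe_set \<beta> f h b r \<Longrightarrow> i < r \<Longrightarrow> grad_u (hcbf \<beta> f h i) z = 0"
    using ca by blast+
  have b1: "cont_diff 1 b" and w1: "cont_diff 1 w" and \<Phi>1: "cont_diff 1 \<Phi>"
    using b2 w \<Phi> by (auto intro: cont_diff_mono simp del: cont_diff.simps)
  have hr2: "cont_diff (Suc 1) hr" unfolding hr_def by (rule cont_diff_hcbf[OF f h]) simp
  have bd: "(b has_derivative frechet_derivative b (at u)) (at u)" for u
    using b1 by (intro cont_diff_has_derivative[of 0]) simp
  have hrd: "(hr has_derivative frechet_derivative hr (at z)) (at z)" for z
    using hr2 by (rule cont_diff_has_derivative)
  define G where "G = pullback_grad w \<Phi>"
  have G1: "cont_diff 1 G" unfolding G_def by (rule cont_diff_pullback_grad[OF w \<Phi>])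
  have cf: "continuous_on S f" and ch: "continuous_on S' h" and cb: "continuous_on S'' b"
    and cw: "continuous_on S'' w" and chr: "continuous_on S hr" and cG: "continuous_on S G"
    and cgb: "continuous_on S'' (grad b)" and cgx: "continuous_on S (grad_x hr)" and cgu: "continuous_on S (grad_u hr)"
    for S S' S''
    using f h b1 w hr2 G1 cont_diff_grad[of 1 b] b2 cont_diff_grad_x[OF hr2] cont_diff_grad_u[OF hr2]
    by (auto intro!: cont_diff_continuous simp: numeral_2_eq_2 simp del: cont_diff.simps)
  have grad\<phi>: "grad (\<lambda>u. \<Phi> (w u)) u = G (w u, u)" for u
    unfolding G_def using w1 \<Phi>1 by (intro grad_compose cont_diff_differentiable[of 0]) auto

  have fw: "f (w u, u) = 0" for u
    using \<open>plant_assumption f w\<close> by (auto simp: plant_assumption_def globally_exp_stable_def)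
  have xs: "xs = w us" and hxs: "h xs \<ge> 0" using so by auto
  have xsI: "(xs, us) \<in> I"
    using hxs \<open>b us > 0\<close> \<open>\<beta> > 0\<close> fw[of us] unfolding I_def safe_set_def xs
    by (auto simp: hcbf_at_equilibrium)
  \<comment> \<open>Barrier functions at an equilibrium are positive multiples of \<open>h\<close>, so \<open>us\<close> is interior to the feasible set.\<close>
  have "hr (xs, us) > 0" using assms(18) xsI by blast
  then have "\<beta> ^ r * h xs > 0" using fw[of us] by (simp add: hr_def xs hcbf_at_equilibrium)
  then have hxs0: "h xs > 0" using \<open>\<beta> > 0\<close> by (simp add: zero_less_mult_iff)
  have Gs: "G (xs, us) = 0"
  proof -
    let ?N = "{u. b u > 0} \<inter> {u. h (w u) > 0}"
    have "grad (\<lambda>u. \<Phi> (w u)) us = 0"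
    proof (rule grad_eq_0_at_minimum[of ?N])
      show "open ?N"
        by (intro open_Int open_Collect_less continuous_on_const cb continuous_on_compose2[OF ch cw]) auto
      show "us \<in> ?N" using \<open>b us > 0\<close> hxs0 xs by simp
      show "\<Phi> (w us) \<le> \<Phi> (w u)" if "u \<in> ?N" for u
      proof -
        have "\<not> \<Phi> (w u) < \<Phi> xs" using so that by (auto simp: less_imp_le)
        then show ?thesis by (simp add: xs)
      qed
      show "(\<lambda>u. \<Phi> (w u)) differentiable at us"
        using w1 \<Phi>1 by (intro differentiable_compose[of \<Phi> w] cont_diff_differentiable[of 0]) auto
    qed
    then show ?thesis by (simp add: grad\<phi> xs)
  qed
  have mono: "(u - us) \<bullet> G (w u, u) \<ge> c * (norm (u - us))\<^sup>2" for u
    using strongly_convex_monotone[OF \<open>strongly_convex c (\<lambda>u. \<Phi> (w u))\<close>, of u us] Gs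
    by (simp add: grad\<phi> xs inner_commute)

  obtain \<eta> where \<eta>: "\<eta> > 0" "\<eta> \<le> b us" and \<eta>h: "\<And>x u. (x, u) \<in> I \<Longrightarrow> \<eta> \<le> hr (x, us)"
  proof -
    have "continuous_on (fst ` I) (\<lambda>x. hr (x, us))"
      by (rule continuous_on_compose2[OF chr]) (auto intro!: continuous_intros)
    then obtain x0 where "x0 \<in> fst ` I" "\<forall>x\<in>fst ` I. hr (x0, us) \<le> hr (x, us)"
      using continuous_attains_inf[of "fst ` I" "\<lambda>x. hr (x, us)"] xsI
        compact_continuous_image[OF continuous_on_fst[OF continuous_on_id] I] by auto
    moreover from this have "hr (x0, us) > 0" using assms(18) by auto
    ultimately show thesis using that[of "min (b us) (hr (x0, us))"] \<open>b us > 0\<close>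
      by (force simp: min_le_iff_disj)
  qed
  have Ib: "b u \<ge> 0" and Ihr: "hr (x, u) \<ge> 0" if "(x, u) \<in> I" for x u
    using that unfolding I_def hr_def safe_set_def by auto
  have slack_b: "grad b u \<bullet> (us - u) \<ge> \<eta> - b u" for u
    using concave_below_tangent[OF \<open>convex_on UNIV (\<lambda>u. - b u)\<close> bd, of us u] \<eta>(2)
    by (simp add: grad_inner[OF bd])
  have slack_hr: "grad_u hr (x, u) \<bullet> (us - u) \<ge> \<eta> - hr (x, u)" if "(x, u) \<in> I" for x u
  proof -
    have "((\<lambda>u. hr (x, u)) has_derivative (\<lambda>v. frechet_derivative hr (at (x, u)) (0, v))) (at u)"
      by (rule has_derivative_compose[OF _ hrd]) (auto intro!: derivative_eq_intros)
    from concave_below_tangent[OF _ this, of us] assms(14)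
    have "hr (x, us) \<le> hr (x, u) + grad_u hr (x, u) \<bullet> (us - u)" by (simp add: grad_u_inner[OF hrd])
    then show ?thesis using \<eta>h[OF that] by linarith
  qed

  obtain M where M1: "M \<ge> 1" and M: "\<And>x u. (x, u) \<in> I \<Longrightarrow> norm (grad b u) \<le> M \<and> norm (grad_u hr (x, u)) \<le> M \<and>
      \<bar>grad_x hr (x, u) \<bullet> f (x, u)\<bar> \<le> M \<and> norm (us - u) \<le> M \<and> norm (G (x, u)) \<le> M \<and> norm (x - w u) \<le> M"
  proof -
    \<comment> \<open>A single bound for the tuple bounds all its components.\<close>
    let ?g = "\<lambda>z. (grad b (snd z), grad_u hr z, grad_x hr z \<bullet> f z, us - snd z, G z, fst z - w (snd z))"
    have "continuous_on UNIV ?g"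
      by (intro continuous_intros cgu cgx cf cG continuous_on_compose2[OF cgb] continuous_on_compose2[OF cw]) auto
    then obtain B where B: "B \<ge> 0" "\<And>z. z \<in> I \<Longrightarrow> norm (?g z) \<le> B"
      using compact_bounded_image[OF I, of ?g] by blast
    show thesis
    proof (rule that[of "B + 1"])
      fix x u assume "(x, u) \<in> I"
      from B(2)[OF this] have le: "norm (grad b u, grad_u hr (x, u), grad_x hr (x, u) \<bullet> f (x, u), us - u, G (x, u), x - w u) \<le> B"
        by simp
      note le2 = order_trans[OF norm_snd_le le]
      note le3 = order_trans[OF norm_snd_le le2]
      note le4 = order_trans[OF norm_snd_le le3]
      note le5 = order_trans[OF norm_snd_le le4]
      show "norm (grad b u) \<le> B + 1 \<and> norm (grad_u hr (x, u)) \<le> B + 1 \<and> \<bar>grad_x hr (x, u) \<bullet> f (x, u)\<bar> \<le> B + 1 \<and>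
         norm (us - u) \<le> B + 1 \<and> norm (G (x, u)) \<le> B + 1 \<and> norm (x - w u) \<le> B + 1"
        using order_trans[OF norm_fst_le le] order_trans[OF norm_fst_le le2] order_trans[OF norm_fst_le le3]
          order_trans[OF norm_fst_le le4] order_trans[OF norm_fst_le le5] order_trans[OF norm_snd_le le5] by simp
    qed (use B in simp)
  qed

  \<comment> \<open>\<open>(w u, u)\<close> may lie outside \<open>I\<close>, so Lipschitz constants are taken on a convex compact set containing both.\<close>
  define Cu where "Cu = convex hull (snd ` I)"
  define Cx where "Cx = convex hull (fst ` I \<union> w ` Cu)"
  have cu: "compact Cu" "convex Cu" unfolding Cu_def
    by (auto intro!: compact_convex_hull compact_continuous_image[OF _ I] continuous_intros)
  have cx: "compact Cx" "convex Cx" unfolding Cx_def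
    by (auto intro!: compact_convex_hull compact_Un compact_continuous_image[OF _ I] compact_continuous_image[OF cw cu(1)] continuous_intros)
  have Iu: "u \<in> Cu" and Ix: "x \<in> Cx" if "(x, u) \<in> I" for x u
    using that by (force simp: Cu_def Cx_def intro!: hull_inc)+
  have wC: "w u \<in> Cx" if "u \<in> Cu" for u using that by (auto simp: Cx_def intro!: hull_inc)
  obtain L where L: "L > 0" "\<And>z z'. z \<in> Cx \<times> Cu \<Longrightarrow> z' \<in> Cx \<times> Cu \<Longrightarrow> norm (G z - G z') \<le> L * norm (z - z')"
    using cont_diff_lipschitz[OF G1 compact_Times[OF cx(1) cu(1)] convex_Times[OF cx(2) cu(2)]] by blast
  obtain N where N: "N > 0" "\<And>u u'. u \<in> Cu \<Longrightarrow> u' \<in> Cu \<Longrightarrow> norm (w u - w u') \<le> N * norm (u - u')"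
    using cont_diff_lipschitz[OF w1 cu] by blast
  have wN: "norm (w u - xs) \<le> N * norm (u - us)" if "(x, u) \<in> I" for x u
    using N(2)[OF Iu[OF that] Iu[OF xsI]] by (simp add: xs)

  \<comment> \<open>\<open>Q\<close> bounds all velocities that are tested, \<open>S (us - u)\<close> is strictly feasible, and \<open>K \<rho> = d\<^sub>4 M \<ge> d\<^sub>4 \<bar>e\<bar>\<close>. None of these depends on \<open>\<epsilon>\<close>, \<open>\<alpha>\<close>, \<open>\<gamma>\<close>.\<close>
  define \<rho> where "\<rho> = \<eta> / (2 * M)"
  define S where "S = 2 * M / \<eta>"
  define Q where "Q = 2 * M + S * M + M + \<rho>"
  define A where "A = 2 * M * (Q + 1) / \<eta>"
  define K where "K = d\<^sub>4 * M / \<rho>"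
  define P where "P = L * (N + 1)"
  define B where "B = d\<^sub>4 * P + (d\<^sub>4 * P + K * L)\<^sup>2 / (2 * K * c)"
  define E where "E = min 1 (d\<^sub>3 / (2 * B))"
  have d: "d\<^sub>1 > 0" "d\<^sub>2 > 0" "d\<^sub>3 > 0" "d\<^sub>4 > 0" using cl by auto
  have pos: "\<rho> > 0" "S > 0" "Q > 0" "A > 0" "K > 0" "P > 0" "B > 0" "E > 0"
  proof -
    show 1: "\<rho> > 0" "S > 0" using \<eta> M1 by (auto simp: \<rho>_def S_def)
    then show 2: "Q > 0" using M1 by (auto simp: Q_def intro!: add_pos_pos)
    then show "A > 0" using \<eta> M1 by (auto simp: A_def intro!: divide_pos_pos mult_pos_pos)
    show 3: "K > 0" using 1 M1 d by (auto simp: K_def)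
    show 4: "P > 0" using L N by (auto simp: P_def)
    show 5: "B > 0" using 3 4 d L \<open>c > 0\<close> by (auto simp: B_def intro!: add_pos_nonneg)
    show "E > 0" using 5 d by (auto simp: E_def)
  qed
  have SA: "S \<le> A"
    unfolding S_def A_def using \<eta> M1 pos(3) by (intro divide_right_mono) auto
  have Wd: "(W has_derivative frechet_derivative W (at z)) (at z)" for z
    using cl by (cases z) (simp add: differentiable_on_def frechet_derivative_works)
  have dW: "frechet_derivative W (at (x, u)) (f (x, u), q) \<le> - d\<^sub>3 * (norm (x - w u))\<^sup>2 + d\<^sub>4 * norm (x - w u) * norm q" for x u q
  proof -
    have "grad_u W (x, u) \<bullet> q \<le> norm (grad_u W (x, u)) * norm q" by (rule norm_cauchy_schwarz)
    also have "\<dots> \<le> d\<^sub>4 * norm (x - w u) * norm q" using cl by (intro mult_right_mono) auto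
    finally show ?thesis using cl unfolding derivative_split[OF Wd] by (smt (verit))
  qed
  have Gbound: "norm (G (x, u)) \<le> P * (norm (x - w u) + norm (u - us))" if xu: "(x, u) \<in> I" for x u
  proof -
    have "norm (G (x, u)) \<le> L * norm ((x, u) - (xs, us))"
      using L(2)[of "(x, u)" "(xs, us)"] Iu Ix xu xsI Gs by auto
    also have "\<dots> \<le> L * (norm (x - xs) + norm (u - us))"
      using L(1) norm_Pair_le[of "x - xs" "u - us"] by (intro mult_left_mono) auto
    also have "\<dots> \<le> L * ((norm (x - w u) + N * norm (u - us)) + norm (u - us))"
      using L(1) wN[OF xu] norm_triangle_ineq[of "x - w u" "w u - xs"] by (intro mult_left_mono) auto
    also have "\<dots> \<le> L * ((N + 1) * (norm (x - w u) + norm (u - us)))"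
      using L(1) N(1) by (intro mult_left_mono) (auto simp: algebra_simps)
    finally show ?thesis by (simp add: P_def mult.assoc)
  qed

  have main: "globally_asymp_stable_rel (sgf_closed_loop \<epsilon> \<alpha> \<gamma> f w \<Phi> hr b)
      {z. sgf_feasible \<alpha> \<gamma> f hr b z \<noteq> {}} I (xs, us)"
    if \<alpha>: "\<alpha> > A" and \<gamma>: "\<gamma> > A" and \<epsilon>: "0 < \<epsilon>" "\<epsilon> < E" for \<alpha> \<gamma> \<epsilon>
  proof -
    let ?F = "sgf_closed_loop \<epsilon> \<alpha> \<gamma> f w \<Phi> hr b"
    let ?g = "sgf \<epsilon> \<alpha> \<gamma> f w \<Phi> hr b"
    let ?Z = "\<lambda>z. halfspace_pair (grad b (snd z)) (\<alpha> * b (snd z)) (grad_u hr z) (grad_x hr z \<bullet> f z + \<gamma> * hr z)"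
    let ?T = "\<lambda>z. - (\<epsilon> *\<^sub>R G z)"
    \<comment> \<open>The states at which both constraints can be met strictly form an open set.\<close>
    define U where "U = (\<Union>q. {z. grad b (snd z) \<bullet> q + \<alpha> * b (snd z) > 0} \<inter>
        {z. grad_u hr z \<bullet> q + (grad_x hr z \<bullet> f z + \<gamma> * hr z) > 0})"
    have feas: "sgf_feasible \<alpha> \<gamma> f hr b z = ?Z z" for z
      using sgf_feasible_halfspace_pair[of \<alpha> \<gamma> f hr b "fst z" "snd z"] by simp
    have g: "?g z = closest_point (?Z z) (?T z)" for z
      using sgf_closest_point[of \<epsilon> \<alpha> \<gamma> f w \<Phi> hr b "fst z" "snd z"] by (simp add: feas G_def pullback_grad_def)
    have c1: "continuous_on UNIV (\<lambda>z::(real^'n)\<times>(real^'m). grad b (snd z))" "continuous_on UNIV (\<lambda>z::(real^'n)\<times>(real^'m). \<alpha> * b (snd z))"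
      "continuous_on UNIV (\<lambda>z. grad_x hr z \<bullet> f z + \<gamma> * hr z)" "continuous_on UNIV ?T"
      by (intro continuous_intros cgx cf chr cG continuous_on_compose2[OF cgb[of UNIV]] continuous_on_compose2[OF cb[of UNIV]]; simp)+
    have strict: "grad b u \<bullet> (S *\<^sub>R (us - u)) + \<alpha> * b u > 0"
        "grad_u hr (x, u) \<bullet> (S *\<^sub>R (us - u)) + (grad_x hr (x, u) \<bullet> f (x, u) + \<gamma> * hr (x, u)) > 0"
      if xu: "(x, u) \<in> I" for x u
      using strictly_feasible_direction[OF slack_b Ib[OF xu] \<eta>(1), of M 0 \<alpha>]
        strictly_feasible_direction[OF slack_hr[OF xu] Ihr[OF xu] \<eta>(1), of M "grad_x hr (x, u) \<bullet> f (x, u)" \<gamma>]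
        M1 M[OF xu] SA \<alpha> \<gamma> unfolding S_def by auto
    show ?thesis
    proof (rule globally_asymp_stable_relI[OF I])
      show "open U" unfolding U_def
        by (intro open_UN ballI open_Int open_Collect_less continuous_on_const continuous_on_add continuous_on_inner c1 cgu)
      show "I \<subseteq> U"
      proof
        fix z assume "z \<in> I"
        then show "z \<in> U" using strict[of "fst z" "snd z"] unfolding U_def
          by (intro UN_I[of "S *\<^sub>R (us - snd z)"]) auto
      qed
      show "U \<subseteq> {z. sgf_feasible \<alpha> \<gamma> f hr b z \<noteq> {}}"
      proof
        fix z assume "z \<in> U"
        then obtain q where "grad b (snd z) \<bullet> q + \<alpha> * b (snd z) > 0"
            "grad_u hr z \<bullet> q + (grad_x hr z \<bullet> f z + \<gamma> * hr z) > 0"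
          unfolding U_def by blast
        then have "q \<in> ?Z z" by (simp add: halfspace_pair_def)
        then show "z \<in> {z. sgf_feasible \<alpha> \<gamma> f hr b z \<noteq> {}}" by (auto simp: feas)
      qed
      have "isCont ?g z" if "z \<in> U" for z
      proof -
        obtain q where "grad b (snd z) \<bullet> q + \<alpha> * b (snd z) > 0"
            "grad_u hr z \<bullet> q + (grad_x hr z \<bullet> f z + \<gamma> * hr z) > 0"
          using \<open>z \<in> U\<close> unfolding U_def by blast
        then show ?thesis
          unfolding g[abs_def] using c1 cgu[of UNIV] unfolding continuous_on_eq_continuous_at[OF open_UNIV]
          by (intro projection_continuous[where ?q0.0 = q]) blast+
      qed
      then show "continuous_on U ?F"
        unfolding sgf_closed_loop_def
        by (intro continuous_on_Pair cf continuous_at_imp_continuous_on) auto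
      show "forward_invariant ?F {z. sgf_feasible \<alpha> \<gamma> f hr b z \<noteq> {}} I"
        unfolding hr_def I_def using f h b1 rel by (rule safe_forward_invariant)
      let ?V = "\<lambda>z. W z + K / 2 * ((snd z - us) \<bullet> (snd z - us))"
      let ?V' = "\<lambda>z v. frechet_derivative W (at z) v + K * ((snd z - us) \<bullet> snd v)"
      show "(?V has_derivative ?V' z) (at z)" for z
        by (auto intro!: derivative_eq_intros Wd simp: inner_commute algebra_simps)
      define C1 where "C1 = 2 / d\<^sub>1 + (2 * N\<^sup>2 + 1) * 2 / K"
      define C2 where "C2 = 2 * d\<^sub>2 + 2 * d\<^sub>2 * N\<^sup>2 + K / 2"
      define \<delta> where "\<delta> = min (d\<^sub>3 / (2 * d\<^sub>2)) (\<epsilon> * c)"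
      have C: "C1 > 0" "C2 > 0" using d pos N by (auto simp: C1_def C2_def intro!: add_pos_pos add_nonneg_pos divide_pos_pos)
      show "1 / C1 > 0" "C2 > 0" using C by auto
      show "\<delta> > 0" using d \<epsilon> \<open>c > 0\<close> by (simp add: \<delta>_def)
      fix z assume "z \<in> I"
      then obtain x u where z: "z = (x, u)" and xu: "(x, u) \<in> I" by (cases z) auto
      define e where "e = norm (x - w u)"
      define y where "y = norm (u - us)"
      have ey: "e \<ge> 0" "y \<ge> 0" by (auto simp: e_def y_def)
      have VW: "?V z = W (x, u) + K / 2 * y\<^sup>2" by (simp add: z y_def power2_norm_eq_inner)
      have Wb: "d\<^sub>1 * e\<^sup>2 \<le> W (x, u)" "W (x, u) \<le> d\<^sub>2 * e\<^sup>2" using cl by (auto simp: e_def)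
      have dist: "(dist z (xs, us))\<^sup>2 = (norm (x - xs))\<^sup>2 + y\<^sup>2"
        by (simp add: z dist_norm norm_Pair y_def)
      have sq: "(s + N * y)\<^sup>2 \<le> 2 * s\<^sup>2 + 2 * N\<^sup>2 * y\<^sup>2" for s
        using zero_le_power2[of "s - N * y"] by (simp add: power2_eq_square algebra_simps)
      have "norm (x - xs) \<le> e + N * y"
        using wN[OF xu] norm_triangle_ineq[of "x - w u" "w u - xs"] by (simp add: e_def y_def)
      then have up: "(norm (x - xs))\<^sup>2 \<le> 2 * e\<^sup>2 + 2 * N\<^sup>2 * y\<^sup>2"
        by (intro order_trans[OF power_mono sq]) auto
      have "e \<le> norm (x - xs) + N * y"
        using wN[OF xu] norm_triangle_ineq[of "x - xs" "xs - w u"] by (simp add: e_def y_def norm_minus_commute)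
      then have lo: "e\<^sup>2 \<le> 2 * (norm (x - xs))\<^sup>2 + 2 * N\<^sup>2 * y\<^sup>2"
        using ey by (intro order_trans[OF power_mono sq]) auto
      have "(dist z (xs, us))\<^sup>2 \<le> C1 * ?V z"
      proof -
        have "(dist z (xs, us))\<^sup>2 \<le> 2 / d\<^sub>1 * (d\<^sub>1 * e\<^sup>2) + (2 * N\<^sup>2 + 1) * 2 / K * (K / 2 * y\<^sup>2)"
        proof -
          have "2 / d\<^sub>1 * (d\<^sub>1 * e\<^sup>2) = 2 * e\<^sup>2" "(2 * N\<^sup>2 + 1) * 2 / K * (K / 2 * y\<^sup>2) = 2 * N\<^sup>2 * y\<^sup>2 + y\<^sup>2"
            using d pos by (simp_all add: field_simps)
          then show ?thesis using up unfolding dist by linarith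
        qed
        also have "\<dots> \<le> C1 * (d\<^sub>1 * e\<^sup>2) + C1 * (K / 2 * y\<^sup>2)"
          using d pos by (intro add_mono mult_right_mono) (auto simp: C1_def)
        also have "\<dots> \<le> C1 * ?V z" unfolding VW using Wb C by (simp add: distrib_left)
        finally show ?thesis .
      qed
      then show "1 / C1 * (dist z (xs, us))\<^sup>2 \<le> ?V z" using C by (simp add: field_simps)
      show "?V z \<le> C2 * (dist z (xs, us))\<^sup>2"
      proof -
        have "?V z \<le> d\<^sub>2 * (2 * (norm (x - xs))\<^sup>2 + 2 * N\<^sup>2 * y\<^sup>2) + K / 2 * y\<^sup>2"
          unfolding VW using Wb(2) mult_left_mono[OF lo less_imp_le[OF d(2)]] by linarith
        also have "\<dots> = 2 * d\<^sub>2 * (norm (x - xs))\<^sup>2 + (2 * d\<^sub>2 * N\<^sup>2 + K / 2) * y\<^sup>2"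
          by (simp add: algebra_simps)
        also have "\<dots> \<le> C2 * (norm (x - xs))\<^sup>2 + C2 * y\<^sup>2"
          using d pos by (intro add_mono mult_right_mono) (auto simp: C2_def)
        finally show ?thesis unfolding dist by (simp add: distrib_left)
      qed
      show "?V' z (?F z) \<le> - \<delta> * ?V z"
      proof -
        let ?q = "?g (x, u)" and ?t = "?T (x, u)"
        define n where "n = norm (?q - ?t)"
        have GM: "norm ?t \<le> M"
        proof -
          have "norm ?t = \<epsilon> * norm (G (x, u))" using \<epsilon> by simp
          also have "\<dots> \<le> 1 * M" using \<epsilon> M[OF xu] by (intro mult_mono) (auto simp: E_def)
          finally show ?thesis by simp
        qed
        have inZ: "?q \<in> ?Z (x, u)" "S *\<^sub>R (us - u) \<in> ?Z (x, u)"
        proof -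
          show 1: "S *\<^sub>R (us - u) \<in> ?Z (x, u)" using strict[OF xu] by (auto simp: halfspace_pair_def)
          show "?q \<in> ?Z (x, u)" unfolding g using 1 by (intro closest_point_in_set closed_halfspace_pair) auto
        qed
        have SM: "norm (S *\<^sub>R (us - u)) \<le> S * M" using M[OF xu] pos by simp
        \<comment> \<open>The bound on \<open>g\<close> is uniform in the gains since \<open>S (us - u)\<close> is feasible for all large ones.\<close>
        have "n \<le> norm (S *\<^sub>R (us - u) - ?t)"
          unfolding n_def g dist_norm[symmetric] dist_commute[of _ ?t]
          by (rule closest_point_le[OF closed_halfspace_pair inZ(2)])
        then have "n \<le> S * M + M" using SM GM norm_triangle_ineq4[of "S *\<^sub>R (us - u)" ?t] by linarith
        then have qM: "norm ?q \<le> 2 * M + S * M"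
          using GM norm_triangle_ineq[of "?q - ?t" ?t] by (simp add: n_def)
        \<comment> \<open>Forced motion is directed towards \<open>us\<close>.\<close>
        have push: "\<rho> * n \<le> (?q - ?t) \<bullet> (us - u)"
          unfolding n_def g
        proof (rule closest_point_push[OF closed_halfspace_pair convex_halfspace_pair])
          fix v :: "real ^ 'm" assume v: "norm v \<le> 1"
          let ?p = "?q + (us - u) + \<rho> *\<^sub>R v"
          have "norm (\<rho> *\<^sub>R v) \<le> \<rho> * 1" using v pos by simp
          then have Q: "norm ?p \<le> Q"
            using qM M[OF xu] norm_triangle_ineq[of "?q + (us - u)" "\<rho> *\<^sub>R v"] norm_triangle_ineq[of ?q "us - u"]
            unfolding Q_def by linarith
          have "grad b u \<bullet> ?p + 0 + \<alpha> * b u \<ge> 0"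
            unfolding \<rho>_def
            by (rule slack_keeps_feasible[OF slack_b Ib[OF xu] \<eta>(1), where M = M and Q = Q])
               (use M1 M[OF xu] inZ(1) v Q \<alpha> in \<open>auto simp: halfspace_pair_def A_def \<rho>_def\<close>)
          moreover have "grad_u hr (x, u) \<bullet> ?p + grad_x hr (x, u) \<bullet> f (x, u) + \<gamma> * hr (x, u) \<ge> 0"
            unfolding \<rho>_def
            by (rule slack_keeps_feasible[OF slack_hr[OF xu] Ihr[OF xu] \<eta>(1), where M = M and Q = Q])
               (use M1 M[OF xu] inZ(1) v Q \<gamma> in \<open>auto simp: halfspace_pair_def A_def \<rho>_def\<close>)
          ultimately show "closest_point (?Z (x, u)) ?t + (us - u) + \<rho> *\<^sub>R v \<in> ?Z (x, u)"
            unfolding g[symmetric] by (simp add: halfspace_pair_def add.assoc)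
        qed (use pos in simp)
        \<comment> \<open>Evaluating the gradient at \<open>x\<close> instead of \<open>w u\<close> costs an error of order \<open>e\<close>.\<close>
        have "(u - us) \<bullet> G (x, u) \<ge> c * y\<^sup>2 - L * e * y"
        proof -
          have "norm (G (x, u) - G (w u, u)) \<le> L * e"
            using L(2)[of "(x, u)" "(w u, u)"] Iu[OF xu] Ix[OF xu] wC[OF Iu[OF xu]] by (simp add: e_def norm_Pair)
          then have "norm (u - us) * norm (G (x, u) - G (w u, u)) \<le> y * (L * e)"
            unfolding y_def by (intro mult_left_mono) auto
          moreover have "- ((u - us) \<bullet> (G (x, u) - G (w u, u))) \<le> norm (u - us) * norm (G (x, u) - G (w u, u))"
            using Cauchy_Schwarz_ineq2[of "u - us" "G (x, u) - G (w u, u)"] by linarith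
          ultimately show ?thesis using mono[of u] by (simp add: inner_diff_right y_def mult.commute mult.left_commute)
        qed
        then have "\<epsilon> * ((u - us) \<bullet> G (x, u)) \<ge> \<epsilon> * (c * y\<^sup>2 - L * e * y)" using \<epsilon> by (intro mult_left_mono) auto
        moreover have "(u - us) \<bullet> ?q = - ((?q - ?t) \<bullet> (us - u)) - \<epsilon> * ((u - us) \<bullet> G (x, u))"
          by (simp add: inner_diff_left inner_diff_right inner_add_left inner_add_right inner_commute right_diff_distrib)
        ultimately have "(u - us) \<bullet> ?q \<le> - \<epsilon> * c * y\<^sup>2 + \<epsilon> * L * e * y - \<rho> * n"
          using push by (simp add: algebra_simps)
        then have uq: "K * ((u - us) \<bullet> ?q) \<le> K * (- \<epsilon> * c * y\<^sup>2 + \<epsilon> * L * e * y - \<rho> * n)"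
          using pos by (intro mult_left_mono) auto
        have "norm ?q \<le> n + \<epsilon> * norm (G (x, u))"
          using norm_triangle_ineq[of "?q - ?t" ?t] \<epsilon> by (simp add: n_def)
        then have "d\<^sub>4 * e * norm ?q \<le> d\<^sub>4 * e * (n + \<epsilon> * norm (G (x, u)))"
          using d ey by (intro mult_left_mono) auto
        moreover have "d\<^sub>4 * e \<le> K * \<rho>"
          using d M[OF xu] pos by (simp add: K_def e_def)
        moreover have "frechet_derivative W (at (x, u)) (f (x, u), ?q) \<le> - d\<^sub>3 * e\<^sup>2 + d\<^sub>4 * e * norm ?q"
          unfolding e_def by (rule dW)
        moreover have "?V' z (?F z) = frechet_derivative W (at (x, u)) (f (x, u), ?q) + K * ((u - us) \<bullet> ?q)"
          by (simp add: z sgf_closed_loop_def)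
        moreover have "norm (G (x, u)) \<le> P * (e + y)" unfolding e_def y_def by (rule Gbound[OF xu])
        moreover have "n \<ge> 0" by (simp add: n_def)
        ultimately have "?V' z (?F z) \<le> - (d\<^sub>3 - \<epsilon> * B) * e\<^sup>2 - \<epsilon> * K * c / 2 * y\<^sup>2"
          using uq lyapunov_arith[of K c \<epsilon> n e d\<^sub>4 \<rho> "norm (G (x, u))" P y d\<^sub>3 L] pos(5) \<open>c > 0\<close> \<epsilon>(1) d(4) ey
          unfolding B_def by linarith
        also have "\<dots> \<le> - (d\<^sub>3 / 2) * e\<^sup>2 - \<epsilon> * K * c / 2 * y\<^sup>2"
        proof -
          have "\<epsilon> * B \<le> d\<^sub>3 / (2 * B) * B" using \<epsilon> pos by (intro mult_right_mono) (auto simp: E_def)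
          also have "\<dots> = d\<^sub>3 / 2" using pos by simp
          finally have "(d\<^sub>3 / 2) * e\<^sup>2 \<le> (d\<^sub>3 - \<epsilon> * B) * e\<^sup>2" by (intro mult_right_mono) auto
          then show ?thesis by (simp add: algebra_simps)
        qed
        also have "\<dots> \<le> - \<delta> * ?V z"
        proof -
          have \<delta>: "0 < \<delta>" "\<delta> \<le> d\<^sub>3 / (2 * d\<^sub>2)" "\<delta> \<le> \<epsilon> * c" using d \<epsilon> \<open>c > 0\<close> by (auto simp: \<delta>_def)
          have "\<delta> * ?V z \<le> \<delta> * (d\<^sub>2 * e\<^sup>2) + \<delta> * (K / 2 * y\<^sup>2)"
            unfolding VW using Wb \<delta> by (simp add: distrib_left)
          also have "\<dots> \<le> d\<^sub>3 / (2 * d\<^sub>2) * (d\<^sub>2 * e\<^sup>2) + \<epsilon> * c * (K / 2 * y\<^sup>2)"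
            using \<delta> d pos by (intro add_mono mult_right_mono) auto
          also have "\<dots> = d\<^sub>3 / 2 * e\<^sup>2 + \<epsilon> * K * c / 2 * y\<^sup>2" using d by simp
          finally show ?thesis by simp
        qed
        finally show ?thesis .
      qed
    qed
  qed
  show ?thesis
    using main pos(4,8) by blast
qed

end
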